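(* Let $A,B\in M_n$ be positive semi-definite matrices. Then for all $0\le t\le 1$, $$\big|\lambda\big(A^t(A\sharp_tB)B^{1-t}\big)\big|\prec_{\log}\lambda(AB).$$
   Context: $M_n$ is the space of $n\times n$ complex matrices. For $X\in M_n$, $|\lambda(X)|$ denotes the vector of absolute values (moduli) of the eigenvalues of $X$ (with multiplicity), arranged in decreasing order; for a matrix $X$ with real eigenvalues, $\lambda(X)$ is the vector of eigenvalues in decreasing order (the eigenvalues of $AB$ are real and nonnegative for $A,B$ positive semi-definite). For vectors $x,y\in\mathbb{R}^n$ with nonnegative entries in decreasing order, $x\prec_{\log}y$ means $\prod_{i=1}^k x_i\le\prod_{i=1}^k y_i$ for $k=1,\dots,n-1$ and $\prod_{i=1}^n x_i=\prod_{i=1}^n y_i$. For positive definite $A,B$ and $0\le t\le1$, $A\sharp_tB=A^{\frac12}(A^{-\frac12}BA^{-\frac12})^tA^{\frac12}$; for positive semi-definite $A,B$, $A\sharp_tB=\lim_{\epsilon\to0^+}(A+\epsilon I_n)\sharp_t(B+\epsilon I_n)$. The zeroth power of a positive semi-definite matrix is the identity. *)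

theory Defs
  imports "Jordan_Normal_Form.Spectral_Radius" "HOL-Computational_Algebra.Fundamental_Theorem_Algebra"
begin

definition hermitian_mat :: "nat \<Rightarrow> complex mat \<Rightarrow> bool" where
  "hermitian_mat n A \<longleftrightarrow> A \<in> carrier_mat n n \<and> mat_adjoint A = A"

definition unitary_mat :: "nat \<Rightarrow> complex mat \<Rightarrow> bool" where
  "unitary_mat n U \<longleftrightarrow> U \<in> carrier_mat n n \<and> mat_adjoint U * U = 1\<^sub>m n"

definition psd_mat :: "nat \<Rightarrow> complex mat \<Rightarrow> bool" where
  "psd_mat n A \<longleftrightarrow> hermitian_mat n A \<and>
     (\<forall>v \<in> carrier_vec n. 0 \<le> Re ((A *\<^sub>v v) \<bullet>c v))"

definition pd_mat :: "nat \<Rightarrow> complex mat \<Rightarrow> bool" where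
  "pd_mat n A \<longleftrightarrow> hermitian_mat n A \<and>
     (\<forall>v \<in> carrier_vec n. v \<noteq> 0\<^sub>v n \<longrightarrow> 0 < Re ((A *\<^sub>v v) \<bullet>c v))"

(* In the library 0 powr 0 = 0, whereas here the zeroth power is always 1. *)
definition rpow :: "real \<Rightarrow> real \<Rightarrow> real" where
  "rpow x t = (if t = 0 then 1 else x powr t)"

(* Functional calculus: the power of a positive semi-definite matrix, the same for every
   spectral decomposition.  A negative exponent is meaningful only for positive definite A. *)
definition mat_powr :: "complex mat \<Rightarrow> real \<Rightarrow> complex mat" where
  "mat_powr A t = (THE P. \<exists>U d. unitary_mat (dim_row A) U \<and> (\<forall>i < dim_row A. 0 \<le> d i) \<and>
     A = U * mat_diag (dim_row A) (\<lambda>i. complex_of_real (d i)) * mat_adjoint U \<and>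
     P = U * mat_diag (dim_row A) (\<lambda>i. complex_of_real (rpow (d i) t)) * mat_adjoint U)"

definition geom_mean_pd :: "real \<Rightarrow> complex mat \<Rightarrow> complex mat \<Rightarrow> complex mat" where
  "geom_mean_pd t A B =
     mat_powr A (1/2) * mat_powr (mat_powr A (-1/2) * B * mat_powr A (-1/2)) t * mat_powr A (1/2)"

(* The matrix type carries no topology; the limit of matrices of fixed size is entrywise. *)
definition geom_mean :: "real \<Rightarrow> complex mat \<Rightarrow> complex mat \<Rightarrow> complex mat" where
  "geom_mean t A B = (let n = dim_row A in
     if pd_mat n A \<and> pd_mat n B then geom_mean_pd t A B
     else Matrix.mat n n (\<lambda>(i, j). Lim (at_right 0) (\<lambda>\<epsilon>::real.
       geom_mean_pd t (A + complex_of_real \<epsilon> \<cdot>\<^sub>m 1\<^sub>m n) (B + complex_of_real \<epsilon> \<cdot>\<^sub>m 1\<^sub>m n) $$ (i, j))))"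

definition eigvals_mset :: "complex mat \<Rightarrow> complex multiset" where
  "eigvals_mset X = proots (char_poly X)"

definition abs_eigvals :: "complex mat \<Rightarrow> real list" where
  "abs_eigvals X = rev (sorted_list_of_multiset (image_mset cmod (eigvals_mset X)))"

(* Only meaningful for a matrix all of whose eigenvalues are real. *)
definition real_eigvals :: "complex mat \<Rightarrow> real list" where
  "real_eigvals X = (THE xs. sorted_wrt (\<ge>) xs \<and>
     image_mset complex_of_real (mset xs) = eigvals_mset X)"

definition log_majorized :: "real list \<Rightarrow> real list \<Rightarrow> bool" (infix \<open>\<prec>log\<close> 50) where
  "x \<prec>log y \<longleftrightarrow> length x = length y \<and>
     (\<forall>k \<in> {1..length x - 1}. prod_list (take k x) \<le> prod_list (take k y)) \<and>
     prod_list x = prod_list y"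

end

theory Submission
  imports Defs
begin

text \<open>Write \<open>R\<^sub>k(X)\<close> for the product of the \<open>k\<close> largest moduli of eigenvalues of \<open>X\<close> (\<open>top_prod k X\<close>
below), and let \<open>M\<close> be the product on the left of the theorem.  The claim is that
\<open>R\<^sub>k(M) \<le> R\<^sub>k(AB)\<close> for every \<open>k\<close>, and that \<open>M\<close> and \<open>AB\<close> have determinants of equal modulus.

The square root of \<open>R\<^sub>k(X\<^sup>* X)\<close> is the product of the \<open>k\<close> largest singular values of \<open>X\<close>.  It
dominates \<open>R\<^sub>k(X)\<close> (\<open>weyl_product_inequality\<close>) and is submultiplicative
(\<open>top_prod_gram_mult\<close>), so it can be used like an operator norm; for \<open>k = 1\<close> it is the operator
norm.  Usually these facts are deduced from the case \<open>k = 1\<close> by passing to exterior powers.  Here they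
come from one determinant inequality, \<open>det_compression\<close>: for positive semi-definite \<open>S\<close> and any
\<open>n \<times> k\<close> matrix \<open>G\<close>, the modulus of \<open>det(G\<^sup>* S G)\<close> is at most \<open>R\<^sub>k(S) det(G\<^sup>* G)\<close>.

Suppose that \<open>A\<close> and \<open>B\<close> are positive definite, and let \<open>Y = A \<sharp>\<^sub>t B\<close>.  Conjugation with a power of \<open>A\<close>
turns \<open>M\<close> into the product of the three factors
\<open>A\<^bsup>t-1/2\<^esup> Y\<^bsup>1/2\<^esup>\<close>, \<open>Y\<^bsup>1/2\<^esup> B\<^bsup>1/2-t\<^esup>\<close> and \<open>B\<^bsup>1/2\<^esup> A\<^bsup>1/2\<^esup>\<close>.
Squaring, it suffices to bound \<open>R\<^sub>k\<close> of the Gram matrices of the factors by \<open>R\<^sub>k(AB)\<^sup>t\<close>,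
\<open>R\<^sub>k(AB)\<^bsup>1-t\<^esup>\<close> and \<open>R\<^sub>k(AB)\<close>.  The last bound is an equality.  The first one is Araki's
inequality \<open>R\<^sub>k(P\<^sup>t Q\<^sup>t P\<^sup>t) \<le> R\<^sub>k(PQP)\<^sup>t\<close> (\<open>araki_log_majorization\<close>) for \<open>P = A\<close> and
\<open>Q = A\<^bsup>-1/2\<^esup> B A\<^bsup>-1/2\<^esup>\<close>, because \<open>A\<^bsup>t-1/2\<^esup> Y A\<^bsup>t-1/2\<^esup> = A\<^sup>t Q\<^sup>t A\<^sup>t\<close>.  The second one is
the first one with the roles of \<open>A\<close> and \<open>B\<close> exchanged, because \<open>A \<sharp>\<^sub>t B = B \<sharp>\<^bsub>1-t\<^esub> A\<close>
(\<open>geom_mean_pd_commute\<close>).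

The semi-definite case follows by letting \<open>\<epsilon>\<close> decrease to \<open>0\<close> in the inequality for \<open>A + \<epsilon> I\<close> and
\<open>B + \<epsilon> I\<close>.  The geometric means converge, because they decrease in the Loewner order
(\<open>geom_mean_pd_mono\<close>, from the Loewner--Heinz inequality, which is Araki's inequality for \<open>k = 1\<close>),
and \<open>R\<^sub>k\<close> passes to the limit along a subsequence (\<open>top_prod_lim_subseq\<close>).\<close>

section \<open>Adjoints and unitary matrices\<close>

(* These rules do not determine the inner dimensions of a product.  Below they are applied with
   all dimensions given. *)
declare assoc_mult_mat [simp del] mult_carrier_mat [simp del]

lemma adjoint_dim [simp]:
  "dim_row (mat_adjoint A) = dim_col A" "dim_col (mat_adjoint A) = dim_row A"
  by (simp_all add: mat_adjoint_def)

lemma adjoint_index [simp]: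
  "i < dim_col A \<Longrightarrow> j < dim_row A \<Longrightarrow> mat_adjoint A $$ (i, j) = conjugate (A $$ (j, i))"
  by (simp add: mat_adjoint_def mat_of_rows_def)

lemma adjoint_carrier [simp]: "mat_adjoint A \<in> carrier_mat n m \<longleftrightarrow> A \<in> carrier_mat m n"
  unfolding carrier_mat_def mem_Collect_eq adjoint_dim by (rule conj_commute)

lemma adjoint_adjoint [simp]: "mat_adjoint (mat_adjoint A) = A"
  by (rule eq_matI) auto

lemma adjoint_mult:
  fixes A B :: "complex mat"
  assumes "A \<in> carrier_mat n m" "B \<in> carrier_mat m k"
  shows "mat_adjoint (A * B) = mat_adjoint B * mat_adjoint A"
  using assms by (intro eq_matI) (auto simp: scalar_prod_def mult.commute)

lemma adjoint_diag_real [simp]: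
  "mat_adjoint (mat_diag n (\<lambda>i. complex_of_real (d i))) = mat_diag n (\<lambda>i. complex_of_real (d i))"
  by (rule eq_matI) (auto simp: mat_diag_def)

lemma adjoint_one [simp]: "mat_adjoint (1\<^sub>m n :: complex mat) = 1\<^sub>m n"
  by (rule eq_matI) auto

lemma adjoint_zero [simp]: "mat_adjoint (0\<^sub>m n m :: complex mat) = 0\<^sub>m m n"
  by (rule eq_matI) auto

lemma det_adjoint:
  fixes A :: "complex mat"
  assumes "A \<in> carrier_mat n n"
  shows "det (mat_adjoint A) = cnj (det A)"
proof -
  interpret comm_ring_hom cnj by unfold_locales auto
  have "mat_adjoint A = transpose_mat (map_mat cnj A)"
    by (rule eq_matI) auto
  moreover have "det (transpose_mat (map_mat cnj A)) = det (map_mat cnj A)"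
    by (rule det_transpose) (use assms in auto)
  ultimately show ?thesis by (simp add: hom_det)
qed

lemma inner_adjoint:
  fixes A :: "complex mat"
  assumes A: "A \<in> carrier_mat n m" and v: "v \<in> carrier_vec m" and w: "w \<in> carrier_vec n"
  shows "(A *\<^sub>v v) \<bullet>c w = v \<bullet>c (mat_adjoint A *\<^sub>v w)"
proof -
  have "(A *\<^sub>v v) \<bullet>c w = (\<Sum>i = 0..<n. \<Sum>j = 0..<m. A $$ (i, j) * v $ j * cnj (w $ i))"
    using A v w by (simp add: scalar_prod_def sum_distrib_right row_def)
  also have "\<dots> = (\<Sum>j = 0..<m. \<Sum>i = 0..<n. A $$ (i, j) * v $ j * cnj (w $ i))"
    by (rule sum.swap)
  also have "\<dots> = v \<bullet>c (mat_adjoint A *\<^sub>v w)"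
    using A v w by (simp add: scalar_prod_def sum_distrib_left row_def mult_ac)
  finally show ?thesis .
qed

lemma inner_self:
  fixes v :: "complex vec"
  assumes "v \<in> carrier_vec n"
  shows "v \<bullet>c v = complex_of_real (\<Sum>i<n. (cmod (v $ i))\<^sup>2)"
  using assms by (simp add: scalar_prod_def complex_mult_cnj cmod_power2 atLeast0LessThan)

lemma unitaryD:
  assumes "unitary_mat n U"
  shows "U \<in> carrier_mat n n" "mat_adjoint U * U = 1\<^sub>m n" "U * mat_adjoint U = 1\<^sub>m n"
  using assms mat_mult_left_right_inverse[of "mat_adjoint U" n U]
  by (auto simp: unitary_mat_def)

lemma unitary_mult:
  assumes U: "unitary_mat n U" and V: "unitary_mat n V"
  shows "unitary_mat n (U * V)"
proof -
  note c = unitaryD[OF U] unitaryD[OF V]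
  have "mat_adjoint (U * V) * (U * V) = mat_adjoint V * (mat_adjoint U * U) * V"
    using c(1,4) by (simp add: adjoint_mult[of _ n n _ n] assoc_mult_mat[of _ n n _ n _ n]
        mult_carrier_mat[of _ n n _ n] del: c)
  also have "\<dots> = 1\<^sub>m n"
    using c by simp
  finally show ?thesis using c mult_carrier_mat[OF c(1,4)] by (simp add: unitary_mat_def)
qed

text \<open>Gram--Schmidt only produces orthogonal columns; rescaling them gives a unitary matrix.\<close>

lemma unitary_with_first_column:
  fixes v :: "complex vec"
  assumes v: "v \<in> carrier_vec n" and v0: "v \<noteq> 0\<^sub>v n"
  obtains U c where "unitary_mat n U" "col U 0 = c \<cdot>\<^sub>v v"
proof -
  interpret cof_vec_space n "TYPE(complex)" .
  have n: "n \<noteq> 0" using v v0 by auto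
  define b where "b = basis_completion v"
  define ws where "ws = gram_schmidt n b"
  note bc = basis_completion[OF v v0, folded b_def]
  have len_b: "length b = n" and hdb: "hd b = v" using bc by auto
  then obtain vs where bv: "b = v # vs" using n by (cases b) auto
  from gram_schmidt_result[OF bc(2) bc(4) bc(5) refl, folded ws_def]
  have ws: "set ws \<subseteq> carrier_vec n" "corthogonal ws" "length ws = n"
    by (auto simp: len_b)
  have hdws: "hd ws = v" using gram_schmidt_hd[OF v, of vs, folded bv] unfolding ws_def .
  then have ws0: "ws ! 0 = v" using ws(3) n by (cases ws) auto
  have wsc: "ws ! i \<in> carrier_vec n" if "i < n" for i using ws that by auto
  define s where "s i = 1 / complex_of_real (sqrt (\<Sum>j<n. (cmod (ws ! i $ j))\<^sup>2))" for i
  define U where "U = Matrix.mat n n (\<lambda>(i, j). s j * ws ! j $ i)"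
  have colU: "col U j = s j \<cdot>\<^sub>v ws ! j" if "j < n" for j
    using wsc[OF that] that by (intro eq_vecI) (auto simp: U_def)
  have ip: "(mat_adjoint U * U) $$ (i, j) = cnj (s i) * s j * (ws ! j \<bullet>c ws ! i)" if "i < n" "j < n" for i j
    using wsc[OF that(1)] wsc[OF that(2)] that
    by (simp add: U_def scalar_prod_def sum_distrib_left mult_ac row_def)
  have "mat_adjoint U * U = 1\<^sub>m n"
  proof (rule eq_matI)
    fix i j assume "i < dim_row (1\<^sub>m n :: complex mat)" "j < dim_col (1\<^sub>m n :: complex mat)"
    then have ij: "i < n" "j < n" by auto
    show "(mat_adjoint U * U) $$ (i, j) = 1\<^sub>m n $$ (i, j)"
    proof (cases "i = j")
      case False
      then have "ws ! j \<bullet>c ws ! i = 0" using corthogonalD[OF ws(2)] ij ws(3) by simp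
      then show ?thesis using ip[OF ij] ij False by simp
    next
      case True
      let ?q = "\<Sum>k<n. (cmod (ws ! i $ k))\<^sup>2"
      have "ws ! i \<bullet>c ws ! i \<noteq> 0" using corthogonalD[OF ws(2), of i i] ij ws(3) by simp
      then have q0: "?q \<noteq> 0" using inner_self[OF wsc[OF ij(1)]] by (metis of_real_0)
      define r where "r = complex_of_real (sqrt ?q)"
      have "?q \<ge> 0" by (rule sum_nonneg) auto
      then have r: "r * r = complex_of_real ?q"
        unfolding r_def by (metis of_real_mult real_sqrt_mult_self abs_of_nonneg)
      then have "r \<noteq> 0" using q0 by (metis mult_zero_left of_real_eq_0_iff)
      moreover have "s i = 1 / r" "cnj (s i) = s i" by (simp_all add: s_def r_def)
      ultimately have "cnj (s i) * s i * (r * r) = 1" by simp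
      then show ?thesis using ip[OF ij] ij True inner_self[OF wsc[OF ij(1)]] by (simp add: r)
    qed
  qed (auto simp: U_def)
  then have "unitary_mat n U" by (simp add: unitary_mat_def U_def)
  moreover have "col U 0 = s 0 \<cdot>\<^sub>v v" using colU[of 0] n ws0 by simp
  ultimately show ?thesis using that by blast
qed

section \<open>The spectral theorem\<close>

lemma hermitian_congruence:
  assumes "hermitian_mat n A" "X \<in> carrier_mat n m"
  shows "hermitian_mat m (mat_adjoint X * A * X)"
  using assms unfolding hermitian_mat_def
  by (simp add: adjoint_mult[of _ m n _ m] adjoint_mult[of _ m n _ n] mult_carrier_mat[of _ m n _ n]
       mult_carrier_mat[of _ m n _ m] assoc_mult_mat[of _ m n _ n _ m] mult_carrier_mat[of _ n n _ m]
       adjoint_mult[of _ n n _ m])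

lemma adjoint_four_block:
  fixes A B C D :: "complex mat"
  assumes "A \<in> carrier_mat a b" "B \<in> carrier_mat a d" "C \<in> carrier_mat c b" "D \<in> carrier_mat c d"
  shows "mat_adjoint (four_block_mat A B C D) =
     four_block_mat (mat_adjoint A) (mat_adjoint C) (mat_adjoint B) (mat_adjoint D)"
  using assms by (intro eq_matI) (auto simp: four_block_mat_def Let_def)

lemma char_poly_unitary_conj:
  assumes U: "unitary_mat n U" and A: "A \<in> carrier_mat n n"
  shows "char_poly (mat_adjoint U * A * U) = char_poly A"
proof (rule char_poly_similar)
  show "similar_mat (mat_adjoint U * A * U) A"
    by (rule similar_matI[where n = n and P = "mat_adjoint U" and Q = U])
      (use unitaryD[OF U] A in auto)
qed

text \<open>Deflation: a unit eigenvector splits off a one-dimensional block, and hermitian symmetry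
  makes the off-diagonal blocks vanish.  Since the eigenvalues are split off one after the other, they
  can be put on the diagonal in any prescribed order.\<close>

theorem spectral_theorem:
  assumes "hermitian_mat n A" and "char_poly A = (\<Prod>e\<leftarrow>es. [:- e, 1:])"
  shows "\<exists>U. unitary_mat n U \<and> A = U * mat_diag n (\<lambda>i. es ! i) * mat_adjoint U"
  using assms
proof (induction es arbitrary: n A)
  case Nil
  have A: "A \<in> carrier_mat n n" using Nil by (simp add: hermitian_mat_def)
  then have "n = 0" using degree_monic_char_poly[OF A] Nil by simp
  then have "unitary_mat n (1\<^sub>m 0)" "A = 1\<^sub>m 0 * mat_diag n (\<lambda>i. [] ! i) * mat_adjoint (1\<^sub>m 0)"
    using A by (auto simp: unitary_mat_def intro!: eq_matI)
  then show ?case by blast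
next
  case (Cons e es)
  have A: "A \<in> carrier_mat n n" and hA: "mat_adjoint A = A" using Cons by (auto simp: hermitian_mat_def)
  have cp: "char_poly A = [:- e, 1:] * (\<Prod>e\<leftarrow>es. [:- e, 1:])" using Cons by simp
  have "eigenvalue A e" unfolding eigenvalue_root_char_poly[OF A] cp by simp
  then obtain v where v: "v \<in> carrier_vec n" "v \<noteq> 0\<^sub>v n" "A *\<^sub>v v = e \<cdot>\<^sub>v v"
    using A unfolding eigenvalue_def eigenvector_def by auto
  then have n0: "n \<noteq> 0" by auto
  then obtain m where n: "n = Suc m" by (cases n) auto
  obtain U c where U: "unitary_mat n U" and U0: "col U 0 = c \<cdot>\<^sub>v v"
    using unitary_with_first_column[OF v(1,2)] .
  note Uc = unitaryD[OF U]
  define A' where "A' = mat_adjoint U * A * U"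
  have A'h: "hermitian_mat n A'" unfolding A'_def by (rule hermitian_congruence) (use Cons Uc in auto)
  then have A': "A' \<in> carrier_mat n n" and hA': "mat_adjoint A' = A'" by (auto simp: hermitian_mat_def)
  have AU: "A = U * A' * mat_adjoint U"
  proof -
    have "U * A' * mat_adjoint U = (U * mat_adjoint U) * A * (U * mat_adjoint U)"
      unfolding A'_def using A Uc(1)
      by (simp add: assoc_mult_mat[of _ n n _ n _ n] mult_carrier_mat[of _ n n _ n])
    then show ?thesis using A Uc by simp
  qed
  have col0: "col A' 0 = e \<cdot>\<^sub>v unit_vec n 0"
  proof -
    have "col A' 0 = (mat_adjoint U * A) *\<^sub>v col U 0"
      unfolding A'_def using A Uc(1) n0 by (intro col_mult2[of _ n n _ n]) auto
    also have "\<dots> = mat_adjoint U *\<^sub>v (A *\<^sub>v (c \<cdot>\<^sub>v v))"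
      using A Uc(1) v unfolding U0 by (intro assoc_mult_mat_vec[of _ n n _ n]) auto
    also have "A *\<^sub>v (c \<cdot>\<^sub>v v) = e \<cdot>\<^sub>v col U 0"
      unfolding U0 using A v by (simp add: mult_mat_vec[of _ n n] smult_smult_assoc mult.commute)
    also have "mat_adjoint U *\<^sub>v (e \<cdot>\<^sub>v col U 0) = e \<cdot>\<^sub>v (mat_adjoint U *\<^sub>v col U 0)"
      by (rule mult_mat_vec[of _ n n]) (use Uc n0 in auto)
    also have "mat_adjoint U *\<^sub>v col U 0 = col (mat_adjoint U * U) 0"
      using Uc(1) n0 by (intro col_mult2[symmetric, of _ n n _ n]) auto
    also have "\<dots> = unit_vec n 0" using Uc n0 by simp
    finally show ?thesis .
  qed
  have c0: "A' $$ (i, 0) = (if i = 0 then e else 0)" if "i < n" for i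
    using arg_cong[OF col0, of "\<lambda>w. w $ i"] A' that n0 by auto
  have r0: "A' $$ (0, i) = 0" if "i < n" "i \<noteq> 0" for i
  proof -
    have "mat_adjoint A' $$ (0, i) = cnj (A' $$ (i, 0))" using A' that n0 by simp
    then show ?thesis using c0[OF that(1)] that(2) hA' by simp
  qed
  define A3 where "A3 = Matrix.mat m m (\<lambda>(i, j). A' $$ (Suc i, Suc j))"
  let ?E = "Matrix.mat 1 1 (\<lambda>_. e)"
  let ?fb = "\<lambda>X Y. four_block_mat X (0\<^sub>m 1 m) (0\<^sub>m m 1) Y"
  have A3: "A3 \<in> carrier_mat m m" by (simp add: A3_def)
  have blk: "A' = ?fb ?E A3"
    using A' n c0 r0 by (intro eq_matI) (auto simp: A3_def)
  have "hermitian_mat m A3"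
  proof -
    have "cnj (A' $$ (Suc j, Suc i)) = A' $$ (Suc i, Suc j)" if "i < m" "j < m" for i j
      using arg_cong[OF hA', of "\<lambda>M. M $$ (Suc i, Suc j)"] A' n that by simp
    then show ?thesis unfolding hermitian_mat_def by (auto simp: A3_def intro!: eq_matI)
  qed
  moreover have "char_poly A3 = (\<Prod>e\<leftarrow>es. [:- e, 1:])"
  proof -
    have "char_poly A' = [:- e, 1:] * (\<Prod>e\<leftarrow>es. [:- e, 1:])"
      unfolding A'_def char_poly_unitary_conj[OF U A] by (rule cp)
    moreover have "char_poly A' = char_poly ?E * char_poly A3"
      unfolding blk by (rule char_poly_four_block_zeros_col) (auto simp: A3)
    moreover have "char_poly ?E = [:- e, 1:]" by (simp add: char_poly_defs det_def sign_def)
    ultimately show ?thesis by (metis mult_cancel_left pCons_eq_0_iff zero_neq_one)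
  qed
  ultimately obtain V where V: "unitary_mat m V"
    and A3V: "A3 = V * mat_diag m (\<lambda>i. es ! i) * mat_adjoint V"
    using Cons.IH by blast
  note Vc = unitaryD[OF V]
  define W where "W = ?fb (1\<^sub>m 1) V"
  have W: "W \<in> carrier_mat n n" unfolding W_def n using Vc by (auto intro!: four_block_carrier_mat[of _ 1 1 _ m m, simplified])
  have Wadj: "mat_adjoint W = ?fb (1\<^sub>m 1) (mat_adjoint V)"
    unfolding W_def using Vc(1)
    by (subst adjoint_four_block[of _ 1 1 _ m _ m]) simp_all
  have fbm: "?fb X Y * ?fb X' Y' = ?fb (X * X') (Y * Y')"
    if "X \<in> carrier_mat 1 1" "X' \<in> carrier_mat 1 1" "Y \<in> carrier_mat m m" "Y' \<in> carrier_mat m m"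
    for X X' Y Y' :: "complex mat"
  proof -
    have "?fb X Y * ?fb X' Y' = four_block_mat (X * X' + 0\<^sub>m 1 m * 0\<^sub>m m 1) (X * 0\<^sub>m 1 m + 0\<^sub>m 1 m * Y')
        (0\<^sub>m m 1 * X' + Y * 0\<^sub>m m 1) (0\<^sub>m m 1 * 0\<^sub>m 1 m + Y * Y')"
      using that by (intro mult_four_block_mat[of _ 1 1 _ m _ m _ _ 1 _ m]) simp_all
    then show ?thesis
      using that mult_carrier_mat[OF that(1,2)] mult_carrier_mat[OF that(3,4)] by simp
  qed
  have Wu: "unitary_mat n W"
  proof -
    have "mat_adjoint W * W = ?fb (1\<^sub>m 1) (1\<^sub>m m)"
      unfolding Wadj unfolding W_def using Vc by (subst fbm) auto
    also have "\<dots> = 1\<^sub>m n" using n by simp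
    finally show ?thesis using W by (simp add: unitary_mat_def)
  qed
  have A'W: "A' = W * mat_diag n (\<lambda>i. (e # es) ! i) * mat_adjoint W"
  proof -
    have d: "mat_diag n (\<lambda>i. (e # es) ! i) = ?fb ?E (mat_diag m (\<lambda>i. es ! i))"
      unfolding n by (rule eq_matI) (auto simp: mat_diag_def)
    have VD: "V * mat_diag m (\<lambda>i. es ! i) \<in> carrier_mat m m"
      using Vc(1) by (intro mult_carrier_mat[of _ m m _ m]) simp_all
    have "W * mat_diag n (\<lambda>i. (e # es) ! i) = ?fb (1\<^sub>m 1 * ?E) (V * mat_diag m (\<lambda>i. es ! i))"
      unfolding d W_def by (rule fbm) (use Vc(1) in simp_all)
    then have "W * mat_diag n (\<lambda>i. (e # es) ! i) * mat_adjoint W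
        = ?fb (1\<^sub>m 1 * ?E * 1\<^sub>m 1) (V * mat_diag m (\<lambda>i. es ! i) * mat_adjoint V)"
      unfolding Wadj using fbm[of "1\<^sub>m 1 * ?E" "1\<^sub>m 1" "V * mat_diag m (\<lambda>i. es ! i)" "mat_adjoint V"] Vc(1) VD
      by simp
    moreover have "1\<^sub>m 1 * ?E * 1\<^sub>m 1 = ?E" by simp
    ultimately show ?thesis unfolding blk A3V by (simp only:)
  qed
  let ?D = "mat_diag n (\<lambda>i. (e # es) ! i)"
  have D: "?D \<in> carrier_mat n n" by simp
  have "(U * W) * ?D * mat_adjoint (U * W) = U * (W * ?D * mat_adjoint W) * mat_adjoint U"
    using W Uc(1) D
    by (simp add: adjoint_mult[of _ n n _ n] assoc_mult_mat[of _ n n _ n _ n] mult_carrier_mat[of _ n n _ n]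
        del: nth_Cons_0 nth_Cons_Suc)
  then have "A = (U * W) * ?D * mat_adjoint (U * W)"
    by (simp only: AU A'W[symmetric])
  then show ?case using unitary_mult[OF U Wu] by blast
qed

section \<open>Lists of eigenvalues\<close>

lemma dim_mat_diag [simp]: "dim_row (mat_diag n f) = n" "dim_col (mat_diag n f) = n"
  by (simp_all add: mat_diag_def)

lemma eigvals_mset_prod:
  assumes "char_poly X = (\<Prod>e\<leftarrow>es. [:- e, 1:])"
  shows "eigvals_mset X = mset es"
proof -
  have "proots (\<Prod>e\<leftarrow>es. [:- e, 1:]) = mset es" for es :: "complex list"
  proof (induction es)
    case (Cons a es)
    have "(\<Prod>e\<leftarrow>es. [:- e, 1:]) \<noteq> 0"
      using monic_prod_list[of "map (\<lambda>e. [:- e, 1:]) es"] by auto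
    then have "proots ([:- a, 1:] * (\<Prod>e\<leftarrow>es. [:- e, 1:])) = proots [:- a, 1:] + proots (\<Prod>e\<leftarrow>es. [:- e, 1:])"
      by (intro proots_mult) auto
    then show ?case using Cons.IH by simp
  qed simp
  then show ?thesis using assms by (simp add: eigvals_mset_def)
qed

lemma abs_eigvals_sorted:
  assumes "char_poly X = (\<Prod>e\<leftarrow>es. [:- e, 1:])" "sorted_wrt (\<lambda>a b. cmod b \<le> cmod a) es"
  shows "abs_eigvals X = map cmod es"
proof -
  have "sorted (rev (map cmod es))"
    using assms(2) by (simp add: sorted_wrt_rev sorted_wrt_map)
  then have "sort (map cmod es) = rev (map cmod es)"
    by (intro properties_for_sort) simp_all
  then show ?thesis
    by (simp add: abs_eigvals_def eigvals_mset_prod[OF assms(1)] flip: mset_map)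
qed

lemma sorted_eigenvalue_list:
  fixes X :: "complex mat"
  assumes "X \<in> carrier_mat n n"
  obtains es where "char_poly X = (\<Prod>e\<leftarrow>es. [:- e, 1:])" "length es = n"
    "sorted_wrt (\<lambda>a b. cmod b \<le> cmod a) es"
proof -
  obtain as where as: "char_poly X = (\<Prod>e\<leftarrow>as. [:- e, 1:])" "length as = n"
    using char_poly_factorized[OF assms] by blast
  define es where "es = rev (sort_key cmod as)"
  have "mset es = mset as" by (simp add: es_def)
  then have "(\<Prod>e\<leftarrow>es. [:- e, 1:]) = (\<Prod>e\<leftarrow>as. [:- e, 1:])"
    by (metis mset_map prod_mset_prod_list)
  moreover have "sorted_wrt (\<lambda>a b. cmod b \<le> cmod a) es"
    using sorted_sort_key[of cmod as] by (simp add: es_def sorted_wrt_rev sorted_wrt_map)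
  moreover have "length es = n" using as by (simp add: es_def)
  ultimately show ?thesis using that[of es] as by simp
qed

definition top_prod :: "nat \<Rightarrow> complex mat \<Rightarrow> real" where
  "top_prod k X = prod_list (take k (abs_eigvals X))"

lemma top_prod_sorted:
  assumes "char_poly X = (\<Prod>e\<leftarrow>es. [:- e, 1:])" "sorted_wrt (\<lambda>a b. cmod b \<le> cmod a) es"
    and "k \<le> length es"
  shows "top_prod k X = (\<Prod>i<k. cmod (es ! i))"
proof -
  have "take k (map cmod es) = map (\<lambda>i. cmod (es ! i)) [0..<k]"
    using assms(3) by (intro nth_equalityI) auto
  then show ?thesis
    using abs_eigvals_sorted[OF assms(1,2)] prod.distinct_set_conv_list[of "[0..<k]" "\<lambda>i. cmod (es ! i)"]
    by (simp add: top_prod_def atLeast0LessThan)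
qed

lemma top_prod_nonneg:
  assumes "X \<in> carrier_mat n n" "k \<le> n"
  shows "0 \<le> top_prod k X"
proof -
  obtain es where "char_poly X = (\<Prod>e\<leftarrow>es. [:- e, 1:])" "length es = n"
    "sorted_wrt (\<lambda>a b. cmod b \<le> cmod a) es"
    using sorted_eigenvalue_list[OF assms(1)] .
  then show ?thesis using assms(2) by (simp add: top_prod_sorted prod_nonneg)
qed

lemma top_prod_cong: "char_poly X = char_poly Y \<Longrightarrow> top_prod k X = top_prod k Y"
  by (simp add: top_prod_def abs_eigvals_def eigvals_mset_def)

lemma top_prod_similar:
  assumes "X \<in> carrier_mat n n" "P \<in> carrier_mat n n" "Q \<in> carrier_mat n n" "P * Q = 1\<^sub>m n"
  shows "top_prod k (P * X * Q) = top_prod k X"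
proof (rule top_prod_cong, rule char_poly_similar)
  show "similar_mat (P * X * Q) X"
    using assms mat_mult_left_right_inverse[OF assms(2,3,4)] mult_carrier_mat[OF mult_carrier_mat[OF assms(2,1)] assms(3)]
    by (intro similar_matI[where n = n]) auto
qed

section \<open>Positive semi-definite matrices\<close>

lemma quad_form_congruence:
  fixes A :: "complex mat"
  assumes "A \<in> carrier_mat n n" "X \<in> carrier_mat n m" "v \<in> carrier_vec m"
  shows "((mat_adjoint X * A * X) *\<^sub>v v) \<bullet>c v = (A *\<^sub>v (X *\<^sub>v v)) \<bullet>c (X *\<^sub>v v)"
proof -
  have Xv: "X *\<^sub>v v \<in> carrier_vec n" using assms by simp
  have "(mat_adjoint X * A * X) *\<^sub>v v = mat_adjoint X *\<^sub>v (A *\<^sub>v (X *\<^sub>v v))"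
    using assms Xv by (simp add: assoc_mult_mat[of _ m n _ n _ m] mult_carrier_mat[of _ n n _ m]
        assoc_mult_mat_vec[of _ m n _ m] assoc_mult_mat_vec[of _ n n _ m])
  then show ?thesis
    using inner_adjoint[of "mat_adjoint X" m n "A *\<^sub>v (X *\<^sub>v v)" v] assms Xv by simp
qed

lemma psd_congruence:
  assumes "psd_mat n A" "X \<in> carrier_mat n m"
  shows "psd_mat m (mat_adjoint X * A * X)"
  using assms hermitian_congruence[of n A X m] quad_form_congruence[of A n X m]
  by (simp add: psd_mat_def hermitian_mat_def)

lemma psd_gram:
  assumes "X \<in> carrier_mat n m"
  shows "psd_mat m (mat_adjoint X * X)"
proof -
  have "psd_mat n (1\<^sub>m n)"
    by (auto simp: psd_mat_def hermitian_mat_def inner_self intro!: sum_nonneg)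
  from psd_congruence[OF this assms] show ?thesis using assms by simp
qed

lemma pd_congruence:
  assumes A: "pd_mat n A" and X: "X \<in> carrier_mat n n" and d: "det X \<noteq> 0"
  shows "pd_mat n (mat_adjoint X * A * X)"
proof -
  have "X *\<^sub>v v \<noteq> 0\<^sub>v n" if "v \<in> carrier_vec n" "v \<noteq> 0\<^sub>v n" for v
    using det_0_iff_vec_prod_zero_field[OF X] d that by blast
  then show ?thesis
    using A X hermitian_congruence[of n A X n] quad_form_congruence[of A n X n]
    by (simp add: pd_mat_def hermitian_mat_def)
qed

lemma pd_imp_psd: "pd_mat n A \<Longrightarrow> psd_mat n A"
proof -
  assume A: "pd_mat n A"
  have "0 \<le> Re ((A *\<^sub>v v) \<bullet>c v)" if "v \<in> carrier_vec n" for v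
  proof (cases "v = 0\<^sub>v n")
    case True
    then show ?thesis using A by (auto simp: pd_mat_def hermitian_mat_def)
  qed (use A that in \<open>auto simp: pd_mat_def less_imp_le\<close>)
  then show ?thesis using A by (simp add: psd_mat_def pd_mat_def)
qed

lemma psd_carrier: "psd_mat n A \<Longrightarrow> A \<in> carrier_mat n n"
  by (simp add: psd_mat_def hermitian_mat_def)

lemma pd_carrier: "pd_mat n A \<Longrightarrow> A \<in> carrier_mat n n"
  by (simp add: pd_mat_def hermitian_mat_def)

abbreviation diag_real :: "nat \<Rightarrow> (nat \<Rightarrow> real) \<Rightarrow> complex mat" where
  "diag_real n d \<equiv> mat_diag n (\<lambda>i. complex_of_real (d i))"

lemma mat_diag_cong: "(\<And>i. i < n \<Longrightarrow> f i = g i) \<Longrightarrow> mat_diag n f = mat_diag n g"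
  by (rule eq_matI) (auto simp: mat_diag_def)

lemma quad_form_diag_complex:
  assumes "v \<in> carrier_vec n"
  shows "(mat_diag n f *\<^sub>v v) \<bullet>c v = (\<Sum>i<n. f i * complex_of_real ((cmod (v $ i))\<^sup>2))"
proof -
  have "(mat_diag n f *\<^sub>v v) $ i = f i * v $ i" if "i < n" for i
  proof -
    have "(mat_diag n f *\<^sub>v v) $ i = (\<Sum>j = 0..<n. (if i = j then f j else 0) * v $ j)"
      using that assms by (simp add: scalar_prod_def mat_diag_def row_def)
    also have "\<dots> = (\<Sum>j = 0..<n. if i = j then f j * v $ j else 0)"
      by (intro sum.cong) auto
    finally show ?thesis using that by simp
  qed
  then show ?thesis using assms
    by (simp add: scalar_prod_def complex_mult_cnj cmod_power2 atLeast0LessThan mult.assoc)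
qed

lemma quad_form_diag:
  assumes "v \<in> carrier_vec n"
  shows "(diag_real n d *\<^sub>v v) \<bullet>c v = complex_of_real (\<Sum>i<n. d i * (cmod (v $ i))\<^sup>2)"
  using quad_form_diag_complex[OF assms, of "\<lambda>i. complex_of_real (d i)"] by simp

lemma unitary_cancel:
  assumes U: "unitary_mat n U" and X: "X \<in> carrier_mat n m"
  shows "mat_adjoint U * (U * X) = X" "U * (mat_adjoint U * X) = X"
  using unitaryD[OF U] X by (simp_all flip: assoc_mult_mat[of _ n n _ n _ m])

text \<open>The eigenvalues of a positive semi-definite matrix are their own moduli.  Listing them in decreasing
  order makes \<open>top_prod\<close> the product of the first diagonal entries.\<close>

lemma psd_spectral:
  assumes S: "psd_mat n S"
  obtains U d where "unitary_mat n U" "S = U * diag_real n d * mat_adjoint U"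
    "\<And>i. i < n \<Longrightarrow> 0 \<le> d i" "\<And>i j. i \<le> j \<Longrightarrow> j < n \<Longrightarrow> d j \<le> d i"
    "\<And>k. k \<le> n \<Longrightarrow> top_prod k S = (\<Prod>i<k. d i)"
proof -
  have Sc: "S \<in> carrier_mat n n" and Sh: "hermitian_mat n S"
    using S by (auto simp: psd_mat_def hermitian_mat_def)
  obtain es where es: "char_poly S = (\<Prod>e\<leftarrow>es. [:- e, 1:])" "length es = n"
    "sorted_wrt (\<lambda>a b. cmod b \<le> cmod a) es"
    using sorted_eigenvalue_list[OF Sc] .
  obtain U where U: "unitary_mat n U" and SU: "S = U * mat_diag n (\<lambda>i. es ! i) * mat_adjoint U"
    using spectral_theorem[OF Sh es(1)] by blast
  note Uc = unitaryD[OF U]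
  let ?D = "mat_diag n (\<lambda>i. es ! i)"
  have Dc: "?D \<in> carrier_mat n n" by simp
  have D: "?D = mat_adjoint U * S * U"
    unfolding SU using Uc Dc
    by (simp add: assoc_mult_mat[of _ n n _ n _ n] mult_carrier_mat[of _ n n _ n] unitary_cancel[OF U, of _ n])
  have Dp: "psd_mat n ?D" unfolding D by (rule psd_congruence[OF S Uc(1)])
  have e: "es ! i = complex_of_real (cmod (es ! i))" if i: "i < n" for i
  proof -
    have "mat_adjoint ?D $$ (i, i) = ?D $$ (i, i)" using Dp by (simp add: psd_mat_def hermitian_mat_def)
    then have "cnj (es ! i) = es ! i" using i by (simp add: mat_diag_def)
    then have im: "Im (es ! i) = 0" by (metis complex_cnj_cancel_iff Reals_cnj_iff complex_is_Real_iff)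
    have "(?D *\<^sub>v unit_vec n i) \<bullet>c unit_vec n i = (\<Sum>j<n. if j = i then es ! j else 0)"
      unfolding quad_form_diag_complex[OF unit_vec_carrier] using i by (intro sum.cong) auto
    also have "\<dots> = es ! i" using i by simp
    finally have "0 \<le> Re (es ! i)"
      using Dp unit_vec_carrier[of n i] unfolding psd_mat_def by metis
    then show ?thesis using im by (simp add: complex_eq_iff cmod_def)
  qed
  have "S = U * diag_real n (\<lambda>i. cmod (es ! i)) * mat_adjoint U"
  proof -
    have "?D = diag_real n (\<lambda>i. cmod (es ! i))"
      by (rule eq_matI) (auto simp: mat_diag_def e[symmetric])
    then show ?thesis using SU by simp
  qed
  moreover have "cmod (es ! j) \<le> cmod (es ! i)" if "i \<le> j" "j < n" for i j
    using es(2,3) that by (cases "i = j") (auto simp: sorted_wrt_iff_nth_less)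
  moreover have "top_prod k S = (\<Prod>i<k. cmod (es ! i))" if "k \<le> n" for k
    using top_prod_sorted[OF es(1,3)] es(2) that by simp
  ultimately show ?thesis using that[of U "\<lambda>i. cmod (es ! i)"] U by simp
qed

section \<open>Determinants of compressions\<close>

text \<open>Cauchy interlacing, in coordinates that diagonalise both a matrix and its compression by the isometry
\<open>Z\<close>.  A vector in the span of the first \<open>j + 1\<close> eigenvectors of the compression can be chosen so that
its image under \<open>Z\<close> has vanishing coordinates below \<open>j\<close>: this is a homogeneous system of \<open>j\<close> equations
in \<open>j + 1\<close> unknowns.  The value of the quadratic form at this vector is at least \<open>m j\<close> times and at most
\<open>l j\<close> times the squared norm.\<close>

lemma cauchy_interlacing:
  assumes Z: "Z \<in> carrier_mat n k" "k \<le> n" and ZZ: "mat_adjoint Z * Z = 1\<^sub>m k"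
    and ZD: "mat_adjoint Z * diag_real n l * Z = diag_real k m"
    and l: "\<And>i j. i \<le> j \<Longrightarrow> j < n \<Longrightarrow> l j \<le> l i"
    and m: "\<And>i j. i \<le> j \<Longrightarrow> j < k \<Longrightarrow> m j \<le> m i"
    and j: "j < k"
  shows "m j \<le> l j"
proof -
  \<comment> \<open>The row of zeros makes the system square, hence singular.\<close>
  let ?M = "mat\<^sub>r (Suc j) (Suc j) (\<lambda>i. if i = j then 0\<^sub>v (Suc j) else vec (Suc j) (\<lambda>q. Z $$ (i, q)))"
  have "det ?M = 0" by (rule det_row_0) auto
  then obtain w where w: "w \<in> carrier_vec (Suc j)" "w \<noteq> 0\<^sub>v (Suc j)" "?M *\<^sub>v w = 0\<^sub>v (Suc j)"
    using det_0_iff_vec_prod_zero_field[of ?M "Suc j"] by auto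
  define y where "y = vec k (\<lambda>q. if q \<le> j then w $ q else 0)"
  have y: "y \<in> carrier_vec k" by (simp add: y_def)
  define x where "x = Z *\<^sub>v y"
  have x: "x \<in> carrier_vec n" using Z y by (simp add: x_def)
  have x0: "x $ i = 0" if i: "i < j" for i
  proof -
    have "x $ i = (\<Sum>q<k. Z $$ (i, q) * y $ q)"
      using i j Z y by (simp add: x_def scalar_prod_def row_def atLeast0LessThan)
    also have "\<dots> = (\<Sum>q<Suc j. Z $$ (i, q) * w $ q)"
      using j by (intro sum.mono_neutral_cong_right) (auto simp: y_def)
    also have "\<dots> = (?M *\<^sub>v w) $ i"
      using i w(1) by (simp add: scalar_prod_def atLeast0LessThan)
    finally show ?thesis using i w(3) by simp
  qed
  have "complex_of_real (\<Sum>i<n. (cmod (x $ i))\<^sup>2) = (1\<^sub>m n *\<^sub>v x) \<bullet>c x"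
    using inner_self[OF x] x by simp
  also have "\<dots> = ((mat_adjoint Z * 1\<^sub>m n * Z) *\<^sub>v y) \<bullet>c y"
    unfolding x_def by (rule quad_form_congruence[symmetric]) (use Z y in auto)
  also have "\<dots> = complex_of_real (\<Sum>q<k. (cmod (y $ q))\<^sup>2)"
    using inner_self[OF y] Z ZZ y by simp
  finally have nrm: "(\<Sum>i<n. (cmod (x $ i))\<^sup>2) = (\<Sum>q<k. (cmod (y $ q))\<^sup>2)"
    by (simp only: of_real_eq_iff)
  have "complex_of_real (\<Sum>i<n. l i * (cmod (x $ i))\<^sup>2) = (diag_real n l *\<^sub>v x) \<bullet>c x"
    using quad_form_diag[OF x] by simp
  also have "\<dots> = ((mat_adjoint Z * diag_real n l * Z) *\<^sub>v y) \<bullet>c y"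
    unfolding x_def by (rule quad_form_congruence[symmetric]) (use Z y in auto)
  also have "\<dots> = complex_of_real (\<Sum>q<k. m q * (cmod (y $ q))\<^sup>2)"
    using quad_form_diag[OF y] ZD by simp
  finally have form: "(\<Sum>i<n. l i * (cmod (x $ i))\<^sup>2) = (\<Sum>q<k. m q * (cmod (y $ q))\<^sup>2)"
    by (simp only: of_real_eq_iff)
  have "m j * (\<Sum>q<k. (cmod (y $ q))\<^sup>2) \<le> (\<Sum>q<k. m q * (cmod (y $ q))\<^sup>2)"
    unfolding sum_distrib_left
  proof (rule sum_mono)
    fix q assume "q \<in> {..<k}"
    show "m j * (cmod (y $ q))\<^sup>2 \<le> m q * (cmod (y $ q))\<^sup>2"
    proof (cases "q \<le> j")
      case True
      then show ?thesis using m[OF True j] by (intro mult_right_mono) auto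
    next
      case False
      then show ?thesis using \<open>q \<in> {..<k}\<close> by (simp add: y_def)
    qed
  qed
  also have "\<dots> = (\<Sum>i<n. l i * (cmod (x $ i))\<^sup>2)" using form by simp
  also have "\<dots> \<le> l j * (\<Sum>i<n. (cmod (x $ i))\<^sup>2)"
    unfolding sum_distrib_left
  proof (rule sum_mono)
    fix i assume "i \<in> {..<n}"
    show "l i * (cmod (x $ i))\<^sup>2 \<le> l j * (cmod (x $ i))\<^sup>2"
    proof (cases "j \<le> i")
      case True
      then show ?thesis using l[OF True] \<open>i \<in> {..<n}\<close> by (intro mult_right_mono) auto
    qed (use x0 in auto)
  qed
  also have "\<dots> = l j * (\<Sum>q<k. (cmod (y $ q))\<^sup>2)" by (simp only: nrm)
  finally have le: "m j * (\<Sum>q<k. (cmod (y $ q))\<^sup>2) \<le> l j * (\<Sum>q<k. (cmod (y $ q))\<^sup>2)" .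
  obtain q where q: "q < Suc j" "w $ q \<noteq> 0"
    using w(1,2) by (metis carrier_vecD eq_vecI index_zero_vec(1) index_zero_vec(2))
  have "0 < (\<Sum>q<k. (cmod (y $ q))\<^sup>2)"
    by (rule sum_pos2[of _ q]) (use q j in \<open>auto simp: y_def\<close>)
  then show ?thesis using le by simp
qed

lemma gram_det_zero:
  fixes G :: "complex mat"
  assumes G: "G \<in> carrier_mat n k" and d: "det (mat_adjoint G * G) = 0"
  obtains y where "y \<in> carrier_vec k" "y \<noteq> 0\<^sub>v k" "G *\<^sub>v y = 0\<^sub>v n"
proof -
  have GG: "mat_adjoint G * G \<in> carrier_mat k k" by (rule mult_carrier_mat) (use G in auto)
  then obtain y where y: "y \<in> carrier_vec k" "y \<noteq> 0\<^sub>v k" "(mat_adjoint G * G) *\<^sub>v y = 0\<^sub>v k"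
    using det_0_iff_vec_prod_zero_field[OF GG] d by auto
  have Gy: "G *\<^sub>v y \<in> carrier_vec n" using G y by simp
  have "(G *\<^sub>v y) \<bullet>c (G *\<^sub>v y) = ((mat_adjoint G * 1\<^sub>m n * G) *\<^sub>v y) \<bullet>c y"
    using quad_form_congruence[OF one_carrier_mat G y(1)] Gy by simp
  also have "\<dots> = 0" using G y by simp
  finally have "G *\<^sub>v y = 0\<^sub>v n" using conjugate_square_eq_0_vec[OF Gy] by simp
  then show ?thesis using that y by blast
qed

lemma cmod_det_mult:
  fixes X Y :: "complex mat"
  shows "X \<in> carrier_mat n n \<Longrightarrow> Y \<in> carrier_mat n n \<Longrightarrow> cmod (det (X * Y)) = cmod (det X) * cmod (det Y)"
  by (simp add: det_mult[of X n Y] norm_mult)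

lemma det_mat_diag: "det (mat_diag n f) = (\<Prod>i<n. f i)"
proof -
  have "det (mat_diag n f) = prod_list (diag_mat (mat_diag n f))"
    by (rule det_upper_triangular[of _ n]) (auto simp: mat_diag_def)
  then show ?thesis by (simp add: prod_list_diag_prod atLeast0LessThan mat_diag_def)
qed

lemma cmod_det_unitary:
  assumes "unitary_mat n U"
  shows "cmod (det U) = 1" "cmod (det (mat_adjoint U)) = 1"
proof -
  note U = unitaryD[OF assms]
  have "cmod (det (mat_adjoint U)) = cmod (det U)" using det_adjoint[OF U(1)] by simp
  moreover have "cmod (det (mat_adjoint U)) * cmod (det U) = 1"
    using cmod_det_mult[of "mat_adjoint U" n U] U by simp
  ultimately have "(cmod (det U))\<^sup>2 = 1" by (simp add: power2_eq_square)
  then show "cmod (det U) = 1" using norm_ge_zero[of "det U"] by (simp add: power2_eq_1_iff)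
  then show "cmod (det (mat_adjoint U)) = 1" using det_adjoint[OF U(1)] by simp
qed

lemma cmod_det_unitary_conj:
  assumes U: "unitary_mat n U" and X: "X \<in> carrier_mat n n"
  shows "cmod (det (U * X * mat_adjoint U)) = cmod (det X)"
  using unitaryD(1)[OF U] X cmod_det_unitary[OF U]
  by (simp add: cmod_det_mult[of _ n] mult_carrier_mat[of _ n n _ n])

text \<open>The determinant of a compression is the product of its eigenvalues, which interlacing bounds one by one
by the \<open>k\<close> largest eigenvalues of \<open>S\<close>.\<close>

lemma det_compression_isometry:
  assumes S: "psd_mat n S" and V: "V \<in> carrier_mat n k" "k \<le> n" "mat_adjoint V * V = 1\<^sub>m k"
  shows "cmod (det (mat_adjoint V * S * V)) \<le> top_prod k S"
proof -
  obtain U l where U: "unitary_mat n U" and SU: "S = U * diag_real n l * mat_adjoint U"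
    and l: "\<And>i. i < n \<Longrightarrow> 0 \<le> l i" "\<And>i j. i \<le> j \<Longrightarrow> j < n \<Longrightarrow> l j \<le> l i"
    and tp: "\<And>k. k \<le> n \<Longrightarrow> top_prod k S = (\<Prod>i<k. l i)"
    using psd_spectral[OF S] by metis
  obtain W m where W: "unitary_mat k W" and VSV: "mat_adjoint V * S * V = W * diag_real k m * mat_adjoint W"
    and m: "\<And>i. i < k \<Longrightarrow> 0 \<le> m i" "\<And>i j. i \<le> j \<Longrightarrow> j < k \<Longrightarrow> m j \<le> m i"
    using psd_spectral[OF psd_congruence[OF S V(1)]] by metis
  note Uc = unitaryD[OF U] and Wc = unitaryD[OF W]
  note Sc = psd_carrier[OF S]
  define Z where "Z = mat_adjoint U * V * W"
  have Dn: "diag_real n l \<in> carrier_mat n n" and Dk: "diag_real k m \<in> carrier_mat k k" by auto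
  have Z: "Z \<in> carrier_mat n k" unfolding Z_def using Uc(1) V(1) Wc(1)
    by (simp add: mult_carrier_mat[of _ n n _ k] mult_carrier_mat[of _ n k _ k])
  note as = assoc_mult_mat[of _ k n _ n _ k] assoc_mult_mat[of _ k n _ k _ k] assoc_mult_mat[of _ n n _ n _ k]
    assoc_mult_mat[of _ n n _ k _ k] assoc_mult_mat[of _ k k _ k _ k] assoc_mult_mat[of _ k k _ n _ k]
    assoc_mult_mat[of _ k k _ n _ n] assoc_mult_mat[of _ k n _ n _ n]
    mult_carrier_mat[of _ n n _ k] mult_carrier_mat[of _ n k _ k] mult_carrier_mat[of _ k n _ n] mult_carrier_mat[of _ k n _ k]
    mult_carrier_mat[of _ k k _ k] mult_carrier_mat[of _ n n _ n] mult_carrier_mat[of _ k k _ n]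
    adjoint_mult[of _ n n _ k] adjoint_mult[of _ n k _ k]
  have "mat_adjoint Z * Z = mat_adjoint W * (mat_adjoint V * (U * (mat_adjoint U * (V * W))))"
    unfolding Z_def using Uc(1) V(1) Wc(1) by (simp add: as)
  also have "\<dots> = mat_adjoint W * ((mat_adjoint V * V) * W)"
    using Uc(1) V(1) Wc(1) by (simp only: unitary_cancel[OF U, of _ k] as adjoint_carrier)
  also have "\<dots> = 1\<^sub>m k" using V(3) Wc by simp
  finally have ZZ: "mat_adjoint Z * Z = 1\<^sub>m k" .
  have "mat_adjoint Z * diag_real n l * Z = mat_adjoint W * ((mat_adjoint V * S * V) * W)"
    unfolding Z_def SU using Uc(1) V(1) Wc(1) Dn
    by (simp add: as assoc_mult_mat[of _ n n _ n _ n])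
  also have "\<dots> = mat_adjoint W * (W * (diag_real k m * (mat_adjoint W * W)))"
    unfolding VSV using Wc(1) Dk by (simp add: as)
  also have "\<dots> = diag_real k m"
    using Wc Dk by (simp add: unitary_cancel[OF W, of _ k])
  finally have ZD: "mat_adjoint Z * diag_real n l * Z = diag_real k m" .
  have "cmod (det (mat_adjoint V * S * V)) = cmod (\<Prod>i<k. complex_of_real (m i))"
    unfolding VSV by (simp add: cmod_det_unitary_conj[OF W] det_mat_diag)
  also have "\<dots> = (\<Prod>i<k. m i)"
    using m(1) by (simp add: prod_norm[symmetric])
  also have "\<dots> \<le> (\<Prod>i<k. l i)"
    using m(1) cauchy_interlacing[OF Z V(2) ZZ ZD l(2) m(2)] by (intro prod_mono) auto
  also have "\<dots> = top_prod k S" using tp V(2) by simp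
  finally show ?thesis .
qed

text \<open>This inequality replaces exterior powers: its two determinants are the values, at the exterior product of
the columns of \<open>G\<close>, of the quadratic forms of the \<open>k\<close>-th exterior powers of \<open>S\<close> and of the identity.  If the columns are
independent, normalising them by an inverse square root of their Gram matrix reduces it to an isometry;
otherwise both determinants vanish.\<close>

lemma det_compression:
  assumes S: "psd_mat n S" and G: "G \<in> carrier_mat n k" "k \<le> n"
  shows "cmod (det (mat_adjoint G * S * G)) \<le> top_prod k S * cmod (det (mat_adjoint G * G))"
proof (cases "det (mat_adjoint G * G) = 0")
  case True
  have Sc: "S \<in> carrier_mat n n" by (rule psd_carrier[OF S])
  obtain y where y: "y \<in> carrier_vec k" "y \<noteq> 0\<^sub>v k" "G *\<^sub>v y = 0\<^sub>v n"
    using gram_det_zero[OF G(1) True] .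
  have GSG: "mat_adjoint G * S * G \<in> carrier_mat k k" and GS: "mat_adjoint G * S \<in> carrier_mat k n"
    using G Sc by (simp_all add: mult_carrier_mat[of _ k n _ n] mult_carrier_mat[of _ k n _ k])
  have "(mat_adjoint G * S * G) *\<^sub>v y = (mat_adjoint G * S) *\<^sub>v (G *\<^sub>v y)"
    by (rule assoc_mult_mat_vec[OF GS G(1) y(1)])
  also have "\<dots> = 0\<^sub>v k" using GS y(3) G by (intro eq_vecI) (auto simp: scalar_prod_def)
  finally have "det (mat_adjoint G * S * G) = 0"
    using det_0_iff_vec_prod_zero_field[OF GSG] y by blast
  then show ?thesis using True by simp
next
  case False
  have Sc: "S \<in> carrier_mat n n" by (rule psd_carrier[OF S])
  obtain W h where W: "unitary_mat k W" and GG: "mat_adjoint G * G = W * diag_real k h * mat_adjoint W"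
    and h0: "\<And>i. i < k \<Longrightarrow> 0 \<le> h i"
    using psd_spectral[OF psd_gram[OF G(1)]] by metis
  note Wc = unitaryD[OF W]
  have dGG: "cmod (det (mat_adjoint G * G)) = (\<Prod>i<k. h i)"
    unfolding GG using h0 by (simp add: cmod_det_unitary_conj[OF W] det_mat_diag prod_norm[symmetric])
  have h: "0 < h i" if "i < k" for i
  proof -
    have "(\<Prod>i<k. h i) \<noteq> 0" using dGG False by (metis norm_eq_zero)
    then have "h i \<noteq> 0" using that by simp
    then show ?thesis using h0[OF that] by simp
  qed
  define R where "R = diag_real k (\<lambda>i. 1 / sqrt (h i))"
  have R: "R \<in> carrier_mat k k" "mat_adjoint R = R" unfolding R_def by (simp_all only: adjoint_diag_real mat_diag_dim)
  define X where "X = W * R"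
  have X: "X \<in> carrier_mat k k" unfolding X_def by (rule mult_carrier_mat[OF Wc(1) R(1)])
  define V where "V = G * X"
  have V: "V \<in> carrier_mat n k" unfolding V_def by (rule mult_carrier_mat[OF G(1) X])
  note as = assoc_mult_mat[of _ k n _ n _ k] assoc_mult_mat[of _ k n _ k _ k] assoc_mult_mat[of _ n n _ n _ k]
    assoc_mult_mat[of _ n n _ k _ k] assoc_mult_mat[of _ k k _ k _ k] assoc_mult_mat[of _ k k _ n _ k]
    assoc_mult_mat[of _ k k _ n _ n] assoc_mult_mat[of _ k n _ n _ n]
    mult_carrier_mat[of _ n n _ k] mult_carrier_mat[of _ n k _ k] mult_carrier_mat[of _ k n _ n] mult_carrier_mat[of _ k n _ k]
    mult_carrier_mat[of _ k k _ k] mult_carrier_mat[of _ n n _ n] mult_carrier_mat[of _ k k _ n]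
    adjoint_mult[of _ n n _ k] adjoint_mult[of _ n k _ k] adjoint_mult[of _ k k _ k]
  have "mat_adjoint V * V = mat_adjoint X * (mat_adjoint G * G) * X"
    unfolding V_def using G(1) X by (simp add: as)
  also have "\<dots> = R * (mat_adjoint W * (W * (diag_real k h * (mat_adjoint W * (W * R)))))"
    unfolding GG X_def using Wc(1) R by (simp add: as)
  also have "\<dots> = R * (diag_real k h * R)"
    using Wc(1) R by (simp add: unitary_cancel[OF W, of _ k] as)
  also have "\<dots> = mat_diag k (\<lambda>i. 1)"
    unfolding R_def mat_diag_diag
  proof (rule mat_diag_cong)
    fix i assume "i < k"
    then have "sqrt (h i) \<noteq> 0" "h i = sqrt (h i) * sqrt (h i)" using h[of i] by simp_all
    then have "1 / sqrt (h i) * (h i * (1 / sqrt (h i))) = 1" by (simp add: field_simps)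
    then show "complex_of_real (1 / sqrt (h i)) * (complex_of_real (h i) * complex_of_real (1 / sqrt (h i))) = 1"
      by (metis of_real_1 of_real_mult)
  qed
  also have "\<dots> = 1\<^sub>m k" by simp
  finally have VV: "mat_adjoint V * V = 1\<^sub>m k" .
  have GSG: "mat_adjoint G * S * G \<in> carrier_mat k k"
    using G Sc by (simp add: mult_carrier_mat[of _ k n _ n] mult_carrier_mat[of _ k n _ k])
  have dX: "cmod (det (mat_adjoint X)) = cmod (det X)" using det_adjoint[OF X] by simp
  have "mat_adjoint V * S * V = mat_adjoint X * (mat_adjoint G * S * G) * X"
    unfolding V_def using G(1) Sc X by (simp add: as)
  then have "cmod (det (mat_adjoint V * S * V)) = (cmod (det X))\<^sup>2 * cmod (det (mat_adjoint G * S * G))"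
    using GSG X dX by (simp add: cmod_det_mult[of _ k] mult_carrier_mat[of _ k k _ k] power2_eq_square)
  moreover have "(cmod (det X))\<^sup>2 * cmod (det (mat_adjoint G * G)) = 1"
  proof -
    have "mat_adjoint X * (mat_adjoint G * G) * X = 1\<^sub>m k"
      using VV unfolding V_def using G(1) X by (simp add: as)
    then have "cmod (det (mat_adjoint X * (mat_adjoint G * G) * X)) = 1" by simp
    then show ?thesis
      using X dX mult_carrier_mat[of "mat_adjoint G" k n G k] G(1)
      by (simp add: cmod_det_mult[of _ k] mult_carrier_mat[of _ k k _ k] power2_eq_square mult_ac)
  qed
  ultimately have "cmod (det (mat_adjoint G * S * G))
      = cmod (det (mat_adjoint V * S * V)) * cmod (det (mat_adjoint G * G))"
    by (simp add: mult_ac)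
  also have "\<dots> \<le> top_prod k S * cmod (det (mat_adjoint G * G))"
    using det_compression_isometry[OF S V G(2) VV] by (intro mult_right_mono) auto
  finally show ?thesis .
qed

section \<open>Products of largest eigenvalues and singular values\<close>

definition first_cols :: "nat \<Rightarrow> nat \<Rightarrow> complex mat" where
  "first_cols n k = Matrix.mat n k (\<lambda>(i, j). if i = j then 1 else 0)"

lemma first_cols_carrier [simp]: "first_cols n k \<in> carrier_mat n k"
  by (simp add: first_cols_def)

lemma first_cols_dim [simp]: "dim_row (first_cols n k) = n" "dim_col (first_cols n k) = k"
  by (simp_all add: first_cols_def)

lemma mult_first_cols:
  assumes "X \<in> carrier_mat m n" "k \<le> n"
  shows "X * first_cols n k = Matrix.mat m k (\<lambda>(i, j). X $$ (i, j))"
proof (rule eq_matI)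
  fix i j assume "i < dim_row (Matrix.mat m k (\<lambda>(i, j). X $$ (i, j)))" "j < dim_col (Matrix.mat m k (\<lambda>(i, j). X $$ (i, j)))"
  then have ij: "i < m" "j < k" by auto
  have "(X * first_cols n k) $$ (i, j) = (\<Sum>q = 0..<n. X $$ (i, q) * (if q = j then 1 else 0))"
    using assms ij by (simp add: first_cols_def scalar_prod_def row_def col_def)
  also have "\<dots> = (\<Sum>q = 0..<n. if q = j then X $$ (i, q) else 0)"
    by (intro sum.cong) auto
  also have "\<dots> = X $$ (i, j)" using ij assms by simp
  finally show "(X * first_cols n k) $$ (i, j) = Matrix.mat m k (\<lambda>(i, j). X $$ (i, j)) $$ (i, j)"
    using ij by simp
qed (use assms in \<open>auto simp: first_cols_def\<close>)

lemma adjoint_first_cols_mult: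
  assumes "X \<in> carrier_mat n m" "k \<le> n"
  shows "mat_adjoint (first_cols n k) * X = Matrix.mat k m (\<lambda>(i, j). X $$ (i, j))"
proof -
  have "mat_adjoint (first_cols n k) * X = mat_adjoint (mat_adjoint X * first_cols n k)"
    using assms by (simp add: adjoint_mult[of _ m n _ k])
  also have "\<dots> = mat_adjoint (Matrix.mat m k (\<lambda>(i, j). mat_adjoint X $$ (i, j)))"
    using assms by (subst mult_first_cols) auto
  also have "\<dots> = Matrix.mat k m (\<lambda>(i, j). X $$ (i, j))"
    using assms by (intro eq_matI) auto
  finally show ?thesis .
qed

text \<open>Weyl's inequality between eigenvalues and singular values.  In a triangularisation of \<open>M\<close> that lists
the eigenvalues by decreasing modulus, the span of the first \<open>k\<close> basis vectors, the columns of \<open>G\<close>, is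
invariant: \<open>M G = G T\<close>, where \<open>T\<close> is triangular with the \<open>k\<close> largest eigenvalues on its diagonal.
Compressing \<open>M\<^sup>* M\<close> by \<open>G\<close> multiplies the Gram determinant of \<open>G\<close> by the square of the modulus of
\<open>det T\<close>.\<close>

lemma weyl_product_inequality:
  assumes M: "M \<in> carrier_mat n n" and k: "k \<le> n"
  shows "(top_prod k M)\<^sup>2 \<le> top_prod k (mat_adjoint M * M)"
proof -
  obtain es where es: "char_poly M = (\<Prod>e\<leftarrow>es. [:- e, 1:])" "length es = n"
    "sorted_wrt (\<lambda>a b. cmod b \<le> cmod a) es"
    using sorted_eigenvalue_list[OF M] .
  obtain B P Q where schur: "schur_decomposition M es = (B, P, Q)" by (metis prod_cases3)
  from schur_decomposition[OF M es(1) schur]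
  have sim: "similar_mat_wit M B P Q" and ut: "upper_triangular B" and dg: "diag_mat B = es" by auto
  note w = similar_mat_witD2[OF M sim]
  let ?E = "first_cols n k"
  define G where "G = P * ?E"
  define T where "T = Matrix.mat k k (\<lambda>(i, j). B $$ (i, j))"
  have G: "G \<in> carrier_mat n k" unfolding G_def by (rule mult_carrier_mat[of _ n n]) (use w in auto)
  have T: "T \<in> carrier_mat k k" by (simp add: T_def)
  have BE: "B * ?E = ?E * T"
  proof (rule eq_matI)
    fix i j assume "i < dim_row (?E * T)" "j < dim_col (?E * T)"
    then have ij: "i < n" "j < k" using T by (auto simp: first_cols_def)
    have "(B * ?E) $$ (i, j) = B $$ (i, j)"
      using mult_first_cols[of B n n k] w k ij by simp
    moreover have "(?E * T) $$ (i, j) = (\<Sum>q = 0..<k. (if i = q then 1 else 0) * T $$ (q, j))"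
      using ij T by (simp add: first_cols_def scalar_prod_def row_def col_def)
    moreover have "\<dots> = (\<Sum>q = 0..<k. if i = q then T $$ (q, j) else 0)" by (intro sum.cong) auto
    moreover have "\<dots> = (if i < k then B $$ (i, j) else 0)" using ij by (simp add: T_def)
    moreover have "B $$ (i, j) = 0" if "\<not> i < k"
      using upper_triangularD[OF ut, of j i] that ij w by auto
    ultimately show "(B * ?E) $$ (i, j) = (?E * T) $$ (i, j)" by auto
  qed (use w T in \<open>auto simp: first_cols_def\<close>)
  have MG: "M * G = G * T"
  proof -
    have "Q * (P * ?E) = ?E"
      using w by (simp flip: assoc_mult_mat[of _ n n _ n _ k])
    then have "M * G = P * (B * ?E)" unfolding G_def
      using w by (simp add: assoc_mult_mat[of _ n n _ n _ k] assoc_mult_mat[of _ n n _ n _ n]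
          mult_carrier_mat[of _ n n _ n] mult_carrier_mat[of _ n n _ k])
    also have "\<dots> = P * (?E * T)" using BE by simp
    also have "\<dots> = G * T" unfolding G_def using w T by (simp add: assoc_mult_mat[of _ n n _ k _ k])
    finally show ?thesis .
  qed
  have detT: "cmod (det T) = top_prod k M"
  proof -
    have "det T = prod_list (diag_mat T)"
      by (rule det_upper_triangular[OF _ T]) (use ut w k in \<open>auto simp: T_def upper_triangular_def\<close>)
    also have "\<dots> = (\<Prod>i<k. T $$ (i, i))" using T by (simp add: prod_list_diag_prod atLeast0LessThan)
    also have "\<dots> = (\<Prod>i<k. es ! i)"
    proof (rule prod.cong)
      fix i assume "i \<in> {..<k}"
      then have "i < k" "i < dim_row B" using k w by auto
      then show "T $$ (i, i) = es ! i" by (simp add: T_def dg[symmetric] diag_mat_def)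
    qed simp
    finally show ?thesis using top_prod_sorted[OF es(1,3)] es(2) k by (simp add: prod_norm)
  qed
  have "det (mat_adjoint G * G) \<noteq> 0"
  proof
    assume "det (mat_adjoint G * G) = 0"
    then obtain y where y: "y \<in> carrier_vec k" "y \<noteq> 0\<^sub>v k" "G *\<^sub>v y = 0\<^sub>v n"
      using gram_det_zero[OF G] by metis
    have Ey: "?E *\<^sub>v y \<in> carrier_vec n" using y by (intro mult_mat_vec_carrier[of _ n k]) auto
    have Pc: "P \<in> carrier_mat n n" and Qc: "Q \<in> carrier_mat n n" using w by auto
    have "?E *\<^sub>v y = (Q * P) *\<^sub>v (?E *\<^sub>v y)" using w(2) Ey by simp
    also have "\<dots> = Q *\<^sub>v (P *\<^sub>v (?E *\<^sub>v y))" by (rule assoc_mult_mat_vec[OF Qc Pc Ey])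
    also have "P *\<^sub>v (?E *\<^sub>v y) = G *\<^sub>v y"
      unfolding G_def by (rule assoc_mult_mat_vec[symmetric, OF Pc _ y(1)]) simp
    also have "Q *\<^sub>v (G *\<^sub>v y) = 0\<^sub>v n" using y(3) Qc by (intro eq_vecI) (auto simp: scalar_prod_def)
    finally have "mat_adjoint ?E *\<^sub>v (?E *\<^sub>v y) = 0\<^sub>v k"
      by (intro eq_vecI) (auto simp: scalar_prod_def first_cols_def)
    moreover have "mat_adjoint ?E *\<^sub>v (?E *\<^sub>v y) = (mat_adjoint ?E * ?E) *\<^sub>v y"
      by (rule assoc_mult_mat_vec[symmetric, of _ k n _ k]) (use y in auto)
    moreover have "mat_adjoint ?E * ?E = 1\<^sub>m k"
      using k by (subst adjoint_first_cols_mult[of _ n k]) (auto simp: first_cols_def)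
    ultimately show False using y by simp
  qed
  moreover have "cmod (det (mat_adjoint G * (mat_adjoint M * M) * G)) = (top_prod k M)\<^sup>2 * cmod (det (mat_adjoint G * G))"
  proof -
    have "mat_adjoint G * (mat_adjoint M * M) * G = mat_adjoint (M * G) * (M * G)"
      using G M by (simp add: adjoint_mult[of _ n n _ k] assoc_mult_mat[of _ k n _ n _ k] assoc_mult_mat[of _ n n _ n _ k]
          mult_carrier_mat[of _ k n _ n] mult_carrier_mat[of _ n n _ n] mult_carrier_mat[of _ n n _ k])
    also have "\<dots> = mat_adjoint T * (mat_adjoint G * G) * T"
      unfolding MG using G T by (simp add: adjoint_mult[of _ n k _ k] assoc_mult_mat[of _ k k _ n _ k] assoc_mult_mat[of _ k k _ k _ k]
          assoc_mult_mat[of _ k n _ k _ k] mult_carrier_mat[of _ k n _ k] mult_carrier_mat[of _ k k _ n] mult_carrier_mat[of _ n k _ k])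
    finally show ?thesis using G T detT det_adjoint[OF T]
      by (simp add: cmod_det_mult[of _ k] mult_carrier_mat[of _ k n _ k] mult_carrier_mat[of _ k k _ k] power2_eq_square mult_ac)
  qed
  ultimately show ?thesis
    using det_compression[OF psd_gram[OF M] G k] by simp
qed

text \<open>Horn's inequality for the singular values of a product.  If the columns of \<open>G\<close> are orthonormal
eigenvectors for the \<open>k\<close> largest eigenvalues of the Gram matrix of \<open>X Y\<close>, compressing this matrix by \<open>G\<close>
gives the left-hand side.  It is also the compression of the Gram matrix of \<open>X\<close> by \<open>Y G\<close>, whose Gram
determinant is in turn a compression of the Gram matrix of \<open>Y\<close>.\<close>

lemma top_prod_gram_mult:
  assumes X: "X \<in> carrier_mat n n" and Y: "Y \<in> carrier_mat n n" and k: "k \<le> n"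
  shows "top_prod k (mat_adjoint (X * Y) * (X * Y)) \<le> top_prod k (mat_adjoint X * X) * top_prod k (mat_adjoint Y * Y)"
proof -
  have XY: "X * Y \<in> carrier_mat n n" by (rule mult_carrier_mat[OF X Y])
  let ?S = "mat_adjoint (X * Y) * (X * Y)"
  obtain U d where U: "unitary_mat n U" and SU: "?S = U * diag_real n d * mat_adjoint U"
    and d: "\<And>i. i < n \<Longrightarrow> 0 \<le> d i"
    and tp: "\<And>k. k \<le> n \<Longrightarrow> top_prod k ?S = (\<Prod>i<k. d i)"
    using psd_spectral[OF psd_gram[OF XY]] by metis
  note Uc = unitaryD[OF U]
  let ?E = "first_cols n k"
  define G where "G = U * ?E"
  have G: "G \<in> carrier_mat n k" unfolding G_def by (rule mult_carrier_mat[of _ n n]) (use Uc in auto)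
  note as = assoc_mult_mat[of _ k n _ n _ k] assoc_mult_mat[of _ n n _ n _ k] assoc_mult_mat[of _ k n _ n _ n]
    mult_carrier_mat[of _ k n _ n] mult_carrier_mat[of _ n n _ n] mult_carrier_mat[of _ n n _ k] mult_carrier_mat[of _ k n _ k]
    adjoint_mult[of _ n n _ k] adjoint_mult[of _ n n _ n]
  have EE: "mat_adjoint ?E * ?E = 1\<^sub>m k"
    using k by (subst adjoint_first_cols_mult[of _ n k]) (auto simp: first_cols_def)
  have GG: "mat_adjoint G * G = 1\<^sub>m k"
    unfolding G_def using Uc EE by (simp add: as unitary_cancel[OF U, of _ k])
  have "mat_adjoint G * ?S * G = mat_adjoint ?E * (diag_real n d * ?E)"
    unfolding G_def SU using Uc(1) by (simp add: as unitary_cancel[OF U, of _ k])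
  also have "\<dots> = diag_real k d"
    using k by (subst adjoint_first_cols_mult[of _ n k], simp add: as, simp, subst mult_first_cols[of _ n n])
      (auto simp: mat_diag_def)
  finally have "top_prod k ?S = cmod (det (mat_adjoint G * ?S * G))"
    using tp[OF k] d k by (simp add: det_mat_diag prod_norm[symmetric])
  also have "mat_adjoint G * ?S * G = mat_adjoint (Y * G) * (mat_adjoint X * X) * (Y * G)"
    using X Y G by (simp add: as)
  also have "cmod (det \<dots>) \<le> top_prod k (mat_adjoint X * X) * cmod (det (mat_adjoint (Y * G) * (Y * G)))"
    by (rule det_compression[OF psd_gram[OF X] _ k]) (rule mult_carrier_mat[OF Y G])
  also have "mat_adjoint (Y * G) * (Y * G) = mat_adjoint G * (mat_adjoint Y * Y) * G"
    using Y G by (simp add: as)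
  also have "cmod (det \<dots>) \<le> top_prod k (mat_adjoint Y * Y)"
    using det_compression[OF psd_gram[OF Y] G k] GG by simp
  finally show ?thesis
    using top_prod_nonneg[of "mat_adjoint X * X" n k] psd_carrier[OF psd_gram[OF X]] k
    by (simp add: mult_left_mono)
qed

section \<open>Real powers of positive matrices\<close>

text \<open>The unitary matrix \<open>Q\<close> that passes between the two eigenbases intertwines the diagonals, so an entry of
\<open>Q\<close> can be nonzero only where the two diagonal entries agree; there \<open>f\<close> agrees as well.  Hence the
description that defines a real power of a matrix determines it uniquely.\<close>

lemma functional_calculus_unique:
  assumes U: "unitary_mat n U" and W: "unitary_mat n W"
    and eq: "U * diag_real n d * mat_adjoint U = W * diag_real n e * mat_adjoint W"
  shows "U * diag_real n (\<lambda>i. f (d i)) * mat_adjoint U = W * diag_real n (\<lambda>i. f (e i)) * mat_adjoint W"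
proof -
  note Uc = unitaryD[OF U] and Wc = unitaryD[OF W]
  note as = assoc_mult_mat[of _ n n _ n _ n] mult_carrier_mat[of _ n n _ n]
    unitary_cancel[OF U, of _ n] unitary_cancel[OF W, of _ n]
  define Q where "Q = mat_adjoint W * U"
  have Q: "Q \<in> carrier_mat n n" unfolding Q_def by (rule mult_carrier_mat[of _ n n]) (use Uc Wc in auto)
  have "mat_adjoint W * (U * diag_real n d * mat_adjoint U) * U = mat_adjoint W * (W * diag_real n e * mat_adjoint W) * U"
    by (simp only: eq)
  then have QD: "Q * diag_real n d = diag_real n e * Q"
    unfolding Q_def using Uc Wc by (simp add: as)
  have QD': "Q * diag_real n (\<lambda>i. f (d i)) = diag_real n (\<lambda>i. f (e i)) * Q"
  proof (rule eq_matI)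
    fix i j assume "i < dim_row (diag_real n (\<lambda>i. f (e i)) * Q)" "j < dim_col (diag_real n (\<lambda>i. f (e i)) * Q)"
    then have ij: "i < n" "j < n" using Q by auto
    have "Q $$ (i, j) * complex_of_real (d j) = complex_of_real (e i) * Q $$ (i, j)"
      using arg_cong[OF QD, of "\<lambda>M. M $$ (i, j)"] ij
      by (simp add: mat_diag_mult_left[OF Q] mat_diag_mult_right[OF Q])
    then have "Q $$ (i, j) = 0 \<or> d j = e i" by auto
    then show "(Q * diag_real n (\<lambda>i. f (d i))) $$ (i, j) = (diag_real n (\<lambda>i. f (e i)) * Q) $$ (i, j)"
      using ij by (auto simp: mat_diag_mult_left[OF Q] mat_diag_mult_right[OF Q])
  qed (use Q in auto)
  have "U * diag_real n (\<lambda>i. f (d i)) * mat_adjoint U = W * (Q * diag_real n (\<lambda>i. f (d i))) * mat_adjoint U"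
    unfolding Q_def using Uc Wc by (simp add: as)
  also have "\<dots> = W * diag_real n (\<lambda>i. f (e i)) * mat_adjoint W"
    unfolding QD' unfolding Q_def using Uc Wc by (simp add: as)
  finally show ?thesis .
qed

lemma mat_powr_diagonalised:
  assumes U: "unitary_mat n U" and d: "\<And>i. i < n \<Longrightarrow> 0 \<le> d i"
    and A: "A = U * diag_real n d * mat_adjoint U"
  shows "mat_powr A t = U * diag_real n (\<lambda>i. rpow (d i) t) * mat_adjoint U"
proof -
  have dim: "dim_row A = n" unfolding A using unitaryD(1)[OF U] by simp
  show ?thesis
    unfolding mat_powr_def dim
  proof (rule the_equality)
    show "\<exists>Ua da. unitary_mat n Ua \<and> (\<forall>i<n. 0 \<le> da i) \<and> A = Ua * diag_real n da * mat_adjoint Ua \<and>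
       U * diag_real n (\<lambda>i. rpow (d i) t) * mat_adjoint U = Ua * diag_real n (\<lambda>i. rpow (da i) t) * mat_adjoint Ua"
      using U d A by blast
  next
    fix P
    assume "\<exists>U d. unitary_mat n U \<and> (\<forall>i<n. 0 \<le> d i) \<and> A = U * diag_real n d * mat_adjoint U \<and>
       P = U * diag_real n (\<lambda>i. rpow (d i) t) * mat_adjoint U"
    then obtain W e where W: "unitary_mat n W" "A = W * diag_real n e * mat_adjoint W"
      and P: "P = W * diag_real n (\<lambda>i. rpow (e i) t) * mat_adjoint W" by blast
    show "P = U * diag_real n (\<lambda>i. rpow (d i) t) * mat_adjoint U"
      unfolding P by (rule functional_calculus_unique[OF W(1) U, where f = "\<lambda>x. rpow x t"]) (use W(2) A in metis)
  qed
qed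

lemma nonzero_vec_index:
  assumes "v \<in> carrier_vec n" "v \<noteq> 0\<^sub>v n"
  obtains q where "q < n" "v $ q \<noteq> 0"
proof -
  have "\<exists>q<n. v $ q \<noteq> 0"
  proof (rule ccontr)
    assume "\<not> (\<exists>q<n. v $ q \<noteq> 0)"
    then have "v = 0\<^sub>v n" using assms(1) by (intro eq_vecI) auto
    then show False using assms(2) by simp
  qed
  then show ?thesis using that by blast
qed

lemma psd_of_diagonalised:
  assumes U: "unitary_mat n U" and d: "\<And>i. i < n \<Longrightarrow> 0 \<le> d i"
  shows "psd_mat n (U * diag_real n d * mat_adjoint U)"
proof -
  have "psd_mat n (diag_real n d)"
    using d by (auto simp: psd_mat_def hermitian_mat_def quad_form_diag intro!: sum_nonneg)
  from psd_congruence[OF this, of "mat_adjoint U" n] show ?thesis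
    using unitaryD(1)[OF U] by simp
qed

lemma pd_of_diagonalised:
  assumes U: "unitary_mat n U" and d: "\<And>i. i < n \<Longrightarrow> 0 < d i"
  shows "pd_mat n (U * diag_real n d * mat_adjoint U)"
proof -
  have "0 < (\<Sum>i<n. d i * (cmod (v $ i))\<^sup>2)" if v: "v \<in> carrier_vec n" "v \<noteq> 0\<^sub>v n" for v :: "complex vec"
  proof -
    obtain q where "q < n" "v $ q \<noteq> 0"
      using nonzero_vec_index[OF v] .
    then have "0 < d q * (cmod (v $ q))\<^sup>2" using d by simp
    moreover have "0 \<le> d i * (cmod (v $ i))\<^sup>2" if "i \<in> {..<n}" for i
      using d[of i] that by simp
    ultimately show ?thesis using \<open>q < n\<close> by (intro sum_pos2[of _ q]) simp_all
  qed
  then have "pd_mat n (diag_real n d)"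
    by (auto simp: pd_mat_def hermitian_mat_def quad_form_diag)
  moreover have "det (mat_adjoint U) \<noteq> 0" using cmod_det_unitary(2)[OF U] by auto
  ultimately show ?thesis
    using pd_congruence[of n "diag_real n d" "mat_adjoint U"] unitaryD(1)[OF U] by simp
qed

lemma pd_spectral:
  assumes A: "pd_mat n A"
  obtains U d where "unitary_mat n U" "A = U * diag_real n d * mat_adjoint U"
    "\<And>i. i < n \<Longrightarrow> 0 < d i" "\<And>k. k \<le> n \<Longrightarrow> top_prod k A = (\<Prod>i<k. d i)"
proof -
  obtain U d where U: "unitary_mat n U" and AU: "A = U * diag_real n d * mat_adjoint U"
    and d: "\<And>i. i < n \<Longrightarrow> 0 \<le> d i" and tp: "\<And>k. k \<le> n \<Longrightarrow> top_prod k A = (\<Prod>i<k. d i)"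
    using psd_spectral[OF pd_imp_psd[OF A]] by metis
  note Uc = unitaryD[OF U]
  have "det U \<noteq> 0" using cmod_det_unitary(1)[OF U] by auto
  then have "pd_mat n (mat_adjoint U * A * U)" using pd_congruence[OF A Uc(1)] by simp
  moreover have "mat_adjoint U * A * U = diag_real n d"
    unfolding AU using Uc by (simp add: assoc_mult_mat[of _ n n _ n _ n] mult_carrier_mat[of _ n n _ n] unitary_cancel[OF U, of _ n])
  ultimately have D: "pd_mat n (diag_real n d)" by simp
  have "0 < d i" if i: "i < n" for i
  proof -
    have "0 < Re ((diag_real n d *\<^sub>v unit_vec n i) \<bullet>c unit_vec n i)"
      using D i unit_vec_nonzero[of n i] unfolding pd_mat_def by (metis index_unit_vec(2) index_zero_vec(1) unit_vec_carrier zero_neq_one)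
    also have "(diag_real n d *\<^sub>v unit_vec n i) \<bullet>c unit_vec n i = complex_of_real (\<Sum>j<n. if j = i then d j else 0)"
      unfolding quad_form_diag[OF unit_vec_carrier] using i by (intro arg_cong[of _ _ complex_of_real] sum.cong) auto
    also have "Re \<dots> = d i" using i by simp
    finally show ?thesis .
  qed
  then show ?thesis using that U AU tp by blast
qed

lemma top_prod_pos:
  assumes "pd_mat n A" "k \<le> n"
  shows "0 < top_prod k A"
proof -
  obtain U d where "unitary_mat n U" "A = U * diag_real n d * mat_adjoint U"
    "\<And>i. i < n \<Longrightarrow> 0 < d i" "top_prod k A = (\<Prod>i<k. d i)"
    using pd_spectral[OF assms(1)] assms(2) by metis
  then show ?thesis using assms(2) by (auto intro!: prod_pos)
qed

lemma rpow_pos: "0 < x \<Longrightarrow> rpow x t = x powr t"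
  by (simp add: rpow_def)

lemma mat_powr_pd_diagonalised:
  assumes U: "unitary_mat n U" and d: "\<And>i. i < n \<Longrightarrow> 0 < d i"
    and A: "A = U * diag_real n d * mat_adjoint U"
  shows "mat_powr A t = U * diag_real n (\<lambda>i. d i powr t) * mat_adjoint U"
proof -
  have "mat_powr A t = U * diag_real n (\<lambda>i. rpow (d i) t) * mat_adjoint U"
    using mat_powr_diagonalised[OF U _ A] d less_imp_le by blast
  also have "diag_real n (\<lambda>i. rpow (d i) t) = diag_real n (\<lambda>i. d i powr t)"
    by (rule mat_diag_cong) (simp add: rpow_pos d)
  finally show ?thesis .
qed

lemma pd_powr_spectral:
  assumes A: "pd_mat n A"
  obtains U d where "unitary_mat n U" "A = U * diag_real n d * mat_adjoint U"
    "\<And>i. i < n \<Longrightarrow> 0 < d i"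
    "\<And>t. mat_powr A t = U * diag_real n (\<lambda>i. d i powr t) * mat_adjoint U"
proof -
  obtain U d where U: "unitary_mat n U" and AU: "A = U * diag_real n d * mat_adjoint U"
    and d: "\<And>i. i < n \<Longrightarrow> 0 < d i"
    using pd_spectral[OF A] by metis
  moreover have "mat_powr A t = U * diag_real n (\<lambda>i. d i powr t) * mat_adjoint U" for t
    using d by (intro mat_powr_pd_diagonalised[OF U _ AU])
  ultimately show ?thesis using that by blast
qed

lemma mat_powr_psd: "psd_mat n A \<Longrightarrow> psd_mat n (mat_powr A t)"
proof -
  assume A: "psd_mat n A"
  obtain U d where U: "unitary_mat n U" and "A = U * diag_real n d * mat_adjoint U"
    and "\<And>i. i < n \<Longrightarrow> 0 \<le> d i"
    using psd_spectral[OF A] by metis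
  then have "mat_powr A t = U * diag_real n (\<lambda>i. rpow (d i) t) * mat_adjoint U"
    by (intro mat_powr_diagonalised)
  then show "psd_mat n (mat_powr A t)"
    using psd_of_diagonalised[OF U] by (simp add: rpow_def)
qed

lemma mat_powr_pd: "pd_mat n A \<Longrightarrow> pd_mat n (mat_powr A t)"
proof -
  assume A: "pd_mat n A"
  obtain U d where U: "unitary_mat n U" and AU: "A = U * diag_real n d * mat_adjoint U"
    and d: "\<And>i. i < n \<Longrightarrow> 0 < d i"
    and pw: "\<And>t. mat_powr A t = U * diag_real n (\<lambda>i. d i powr t) * mat_adjoint U"
    using pd_powr_spectral[OF A] by blast
  have "0 < d i powr t" if "i < n" for i using d[OF that] by simp
  then show "pd_mat n (mat_powr A t)"
    unfolding pw by (rule pd_of_diagonalised[OF U])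
qed

lemma mat_powr_carrier: "psd_mat n A \<Longrightarrow> mat_powr A t \<in> carrier_mat n n"
  by (simp add: mat_powr_psd psd_carrier)

lemma mat_powr_carrier_pd [simp]: "pd_mat n A \<Longrightarrow> mat_powr A t \<in> carrier_mat n n"
  by (simp add: mat_powr_carrier pd_imp_psd)

lemma mat_powr_adjoint [simp]: "pd_mat n A \<Longrightarrow> mat_adjoint (mat_powr A t) = mat_powr A t"
  using mat_powr_pd[of n A t] by (simp add: pd_mat_def hermitian_mat_def)

lemma mat_powr_add:
  assumes "pd_mat n A"
  shows "mat_powr A s * mat_powr A t = mat_powr A (s + t)"
proof -
  obtain U d where U: "unitary_mat n U" and AU: "A = U * diag_real n d * mat_adjoint U"
    and d: "\<And>i. i < n \<Longrightarrow> 0 < d i"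
    and pw: "\<And>t. mat_powr A t = U * diag_real n (\<lambda>i. d i powr t) * mat_adjoint U"
    using pd_powr_spectral[OF assms] by blast
  have "mat_powr A s * mat_powr A t = U * (diag_real n (\<lambda>i. d i powr s) * diag_real n (\<lambda>i. d i powr t)) * mat_adjoint U"
    unfolding pw using unitaryD(1)[OF U]
    by (simp add: assoc_mult_mat[of _ n n _ n _ n] mult_carrier_mat[of _ n n _ n] unitary_cancel[OF U, of _ n] del: mat_diag_diag)
  also have "\<dots> = mat_powr A (s + t)"
    unfolding pw by (simp add: powr_add)
  finally show ?thesis .
qed

lemma mat_powr_zero:
  assumes "psd_mat n A"
  shows "mat_powr A 0 = 1\<^sub>m n"
proof -
  obtain U d where U: "unitary_mat n U" and "A = U * diag_real n d * mat_adjoint U"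
    and "\<And>i. i < n \<Longrightarrow> 0 \<le> d i"
    using psd_spectral[OF assms] by metis
  then have "mat_powr A 0 = U * diag_real n (\<lambda>i. rpow (d i) 0) * mat_adjoint U"
    by (intro mat_powr_diagonalised)
  then show ?thesis using unitaryD[OF U] by (simp add: rpow_def)
qed

lemma mat_powr_one:
  assumes "psd_mat n A"
  shows "mat_powr A 1 = A"
proof -
  obtain U d where U: "unitary_mat n U" and A: "A = U * diag_real n d * mat_adjoint U"
    and d: "\<And>i. i < n \<Longrightarrow> 0 \<le> d i"
    using psd_spectral[OF assms] by metis
  then have "mat_powr A 1 = U * diag_real n (\<lambda>i. rpow (d i) 1) * mat_adjoint U"
    by (intro mat_powr_diagonalised)
  also have "diag_real n (\<lambda>i. rpow (d i) 1) = diag_real n d"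
    by (rule mat_diag_cong) (simp add: rpow_def d)
  finally show ?thesis using A by simp
qed

lemma mat_powr_powr:
  assumes "pd_mat n A"
  shows "mat_powr (mat_powr A s) t = mat_powr A (s * t)"
proof -
  obtain U d where U: "unitary_mat n U" and AU: "A = U * diag_real n d * mat_adjoint U"
    and d: "\<And>i. i < n \<Longrightarrow> 0 < d i"
    and pw: "\<And>t. mat_powr A t = U * diag_real n (\<lambda>i. d i powr t) * mat_adjoint U"
    using pd_powr_spectral[OF assms] by blast
  have "mat_powr (mat_powr A s) t = U * diag_real n (\<lambda>i. (d i powr s) powr t) * mat_adjoint U"
  proof (rule mat_powr_pd_diagonalised[OF U _ pw])
    show "0 < d i powr s" if "i < n" for i using d[OF that] by simp
  qed
  then show ?thesis unfolding pw by (simp add: powr_powr)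
qed

lemma cmod_det_mat_powr:
  assumes "pd_mat n A"
  shows "cmod (det (mat_powr A t)) = cmod (det A) powr t"
proof -
  obtain U d where U: "unitary_mat n U" and AU: "A = U * diag_real n d * mat_adjoint U"
    and d: "\<And>i. i < n \<Longrightarrow> 0 < d i"
    and pw: "\<And>t. mat_powr A t = U * diag_real n (\<lambda>i. d i powr t) * mat_adjoint U"
    using pd_powr_spectral[OF assms] by blast
  have "cmod (det (mat_powr A t)) = (\<Prod>i<n. d i powr t)"
    unfolding pw
    by (simp add: cmod_det_unitary_conj[OF U] det_mat_diag prod_norm[symmetric])
  also have "\<dots> = (\<Prod>i<n. d i) powr t"
    using d by (simp add: prod_powr_distrib less_imp_le)
  also have "(\<Prod>i<n. d i) = cmod (det A)"
    unfolding AU using less_imp_le[OF d] by (simp add: cmod_det_unitary_conj[OF U] det_mat_diag prod_norm[symmetric])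
  finally show ?thesis .
qed

lemma top_prod_commute:
  assumes X: "X \<in> carrier_mat n n" and Y: "Y \<in> carrier_mat n n" and d: "det X \<noteq> 0"
  shows "top_prod k (X * Y) = top_prod k (Y * X)"
proof -
  obtain X' where X': "X' \<in> carrier_mat n n" "X * X' = 1\<^sub>m n"
    using det_non_zero_imp_unit[OF X d, of undefined] unfolding Units_def by (auto simp: ring_mat_simps)
  have "X * (Y * X) * X' = X * Y * (X * X')"
    using X Y X' by (simp add: assoc_mult_mat[of _ n n _ n _ n] mult_carrier_mat[of _ n n _ n])
  also have "\<dots> = X * Y" using X Y X' mult_carrier_mat[OF X Y] by simp
  finally show ?thesis
    using top_prod_similar[OF mult_carrier_mat[OF Y X] X X'] by simp
qed

lemma det_pd_nonzero: "pd_mat n A \<Longrightarrow> det A \<noteq> 0"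
proof -
  assume A: "pd_mat n A"
  have "A *\<^sub>v v \<noteq> 0\<^sub>v n" if v: "v \<in> carrier_vec n" "v \<noteq> 0\<^sub>v n" for v
  proof
    assume "A *\<^sub>v v = 0\<^sub>v n"
    then have "(A *\<^sub>v v) \<bullet>c v = 0" using v by simp
    moreover have "0 < Re ((A *\<^sub>v v) \<bullet>c v)" using A v by (simp add: pd_mat_def)
    ultimately show False by simp
  qed
  then show ?thesis using det_0_iff_vec_prod_zero_field[OF pd_carrier[OF A]] by blast
qed

lemma det_mat_powr_nonzero: "pd_mat n A \<Longrightarrow> det (mat_powr A t) \<noteq> 0"
  by (rule det_pd_nonzero[OF mat_powr_pd])

section \<open>Limits of matrices and of their eigenvalues\<close>

definition mat_lim :: "nat \<Rightarrow> (nat \<Rightarrow> complex mat) \<Rightarrow> complex mat \<Rightarrow> bool" where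
  "mat_lim n X L \<longleftrightarrow> (\<forall>m. X m \<in> carrier_mat n n) \<and> L \<in> carrier_mat n n \<and>
     (\<forall>i<n. \<forall>j<n. (\<lambda>m. X m $$ (i, j)) \<longlonglongrightarrow> L $$ (i, j))"

lemma mat_limD:
  assumes "mat_lim n X L"
  shows "X m \<in> carrier_mat n n" "L \<in> carrier_mat n n"
    "i < n \<Longrightarrow> j < n \<Longrightarrow> (\<lambda>m. X m $$ (i, j)) \<longlonglongrightarrow> L $$ (i, j)"
  using assms by (auto simp: mat_lim_def)

lemma mat_lim_const: "A \<in> carrier_mat n n \<Longrightarrow> mat_lim n (\<lambda>_. A) A"
  by (simp add: mat_lim_def)

lemma mat_lim_subseq: "mat_lim n X L \<Longrightarrow> strict_mono r \<Longrightarrow> mat_lim n (\<lambda>m. X (r m)) L"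
  unfolding mat_lim_def by (auto intro: LIMSEQ_subseq_LIMSEQ[unfolded o_def])

lemma mat_lim_mult:
  assumes X: "mat_lim n X K" and Y: "mat_lim n Y L"
  shows "mat_lim n (\<lambda>m. X m * Y m) (K * L)"
proof -
  note Xc = mat_limD[OF X] and Yc = mat_limD[OF Y]
  have e: "(A * B) $$ (i, j) = (\<Sum>q = 0..<n. A $$ (i, q) * B $$ (q, j))"
    if "A \<in> carrier_mat n n" "B \<in> carrier_mat n n" "i < n" "j < n" for A B :: "complex mat" and i j
    using that by (simp add: scalar_prod_def row_def col_def)
  have "(\<lambda>m. (X m * Y m) $$ (i, j)) \<longlonglongrightarrow> (K * L) $$ (i, j)" if ij: "i < n" "j < n" for i j
    unfolding e[OF Xc(2) Yc(2) ij] e[OF Xc(1) Yc(1) ij]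
    by (intro tendsto_sum tendsto_mult Xc(3) Yc(3)) (use ij in auto)
  then show ?thesis unfolding mat_lim_def
    using mult_carrier_mat[OF Xc(1) Yc(1)] mult_carrier_mat[OF Xc(2) Yc(2)] by blast
qed

lemma mat_lim_diag:
  assumes "\<And>i. i < n \<Longrightarrow> (\<lambda>m. f m i) \<longlonglongrightarrow> g i"
  shows "mat_lim n (\<lambda>m. diag_real n (f m)) (diag_real n g)"
  unfolding mat_lim_def using assms by (auto simp: mat_diag_def intro!: tendsto_of_real)

lemma det_lim:
  assumes "mat_lim n X L"
  shows "(\<lambda>m. det (X m)) \<longlonglongrightarrow> det L"
proof -
  note c = mat_limD[OF assms]
  show ?thesis
    unfolding det_def'[OF c(1)] det_def'[OF c(2)]
    by (intro tendsto_sum tendsto_mult tendsto_prod tendsto_const c(3))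
      (auto simp: permutes_in_image dest: permutes_in_image)
qed

lemma mat_powr_lim_exponent:
  assumes P: "pd_mat n P" and t: "t \<longlonglongrightarrow> s"
  shows "mat_lim n (\<lambda>m. mat_powr P (t m)) (mat_powr P s)"
proof -
  obtain U d where U: "unitary_mat n U" and "P = U * diag_real n d * mat_adjoint U"
    and d: "\<And>i. i < n \<Longrightarrow> 0 < d i"
    and pw: "\<And>t. mat_powr P t = U * diag_real n (\<lambda>i. d i powr t) * mat_adjoint U"
    using pd_powr_spectral[OF P] by blast
  have "(\<lambda>m. d i powr t m) \<longlonglongrightarrow> d i powr s" if "i < n" for i
    using d[OF that] by (intro tendsto_powr tendsto_const t) simp
  then show ?thesis
    unfolding pw using unitaryD(1)[OF U]
    by (intro mat_lim_mult mat_lim_const mat_lim_diag) simp_all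
qed

lemma diagonalised_shift:
  assumes U: "unitary_mat n U" "A = U * diag_real n d * mat_adjoint U"
  shows "A + complex_of_real e \<cdot>\<^sub>m 1\<^sub>m n = U * diag_real n (\<lambda>i. d i + e) * mat_adjoint U"
proof -
  note Uc = unitaryD[OF U(1)]
  have D: "diag_real n (\<lambda>i. d i + e) = diag_real n d + complex_of_real e \<cdot>\<^sub>m 1\<^sub>m n"
    by (rule eq_matI) (auto simp: mat_diag_def)
  have UD: "U * diag_real n d \<in> carrier_mat n n" using Uc(1) by (simp add: mult_carrier_mat[of _ n n _ n])
  have "U * diag_real n (\<lambda>i. d i + e) * mat_adjoint U
     = (U * diag_real n d + complex_of_real e \<cdot>\<^sub>m U) * mat_adjoint U"
    unfolding D using Uc(1) by (simp add: mult_add_distrib_mat[of _ n n _ n] mult_smult_distrib[of _ n n _ n])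
  also have "\<dots> = U * diag_real n d * mat_adjoint U + complex_of_real e \<cdot>\<^sub>m 1\<^sub>m n"
    using Uc UD by (simp add: add_mult_distrib_mat[of _ n n _ _ n] mult_smult_assoc_mat[of _ n n _ n])
  finally show ?thesis using U(2) by simp
qed

lemma pd_shift:
  assumes A: "psd_mat n A" and e: "0 < e"
  shows "pd_mat n (A + complex_of_real e \<cdot>\<^sub>m 1\<^sub>m n)"
proof -
  obtain U d where U: "unitary_mat n U" "A = U * diag_real n d * mat_adjoint U"
    and d: "\<And>i. i < n \<Longrightarrow> 0 \<le> d i"
    using psd_spectral[OF A] by metis
  show ?thesis unfolding diagonalised_shift[OF U]
    by (rule pd_of_diagonalised[OF U(1)]) (use d e in \<open>simp add: add_nonneg_pos\<close>)
qed

text \<open>A nonnegative exponent is what makes the power continuous at a zero eigenvalue.  For \<open>t = 0\<close> this needs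
the convention that the zeroth power is the identity.\<close>

lemma mat_powr_lim_shift:
  assumes A: "psd_mat n A" and t: "0 \<le> t" and e: "\<And>m. 0 < e m" "e \<longlonglongrightarrow> 0"
  shows "mat_lim n (\<lambda>m. mat_powr (A + complex_of_real (e m) \<cdot>\<^sub>m 1\<^sub>m n) t) (mat_powr A t)"
proof -
  obtain U d where U: "unitary_mat n U" "A = U * diag_real n d * mat_adjoint U"
    and d: "\<And>i. i < n \<Longrightarrow> 0 \<le> d i"
    using psd_spectral[OF A] by metis
  have pw: "mat_powr A t = U * diag_real n (\<lambda>i. rpow (d i) t) * mat_adjoint U"
    using d by (intro mat_powr_diagonalised[OF U(1) _ U(2)])
  have pws: "mat_powr (A + complex_of_real (e m) \<cdot>\<^sub>m 1\<^sub>m n) t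
      = U * diag_real n (\<lambda>i. rpow (d i + e m) t) * mat_adjoint U" for m
    using d less_imp_le[OF e(1)[of m]] by (intro mat_powr_diagonalised[OF U(1) _ diagonalised_shift[OF U]]) simp
  have "(\<lambda>m. rpow (d i + e m) t) \<longlonglongrightarrow> rpow (d i) t" if i: "i < n" for i
  proof (cases "t = 0")
    case False
    have "(\<lambda>m. d i + e m) \<longlonglongrightarrow> d i + 0" by (intro tendsto_add tendsto_const e(2))
    then have "(\<lambda>m. (d i + e m) powr t) \<longlonglongrightarrow> (d i + 0) powr t"
      using t False d[OF i] e(1) by (intro tendsto_powr' tendsto_const) (auto intro!: always_eventually add_nonneg_nonneg less_imp_le)
    then show ?thesis using False by (simp add: rpow_def)
  qed (simp add: rpow_def)
  then show ?thesis
    unfolding pw pws using unitaryD(1)[OF U(1)]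
    by (intro mat_lim_mult mat_lim_const mat_lim_diag) simp_all
qed

text \<open>Compare the two sides of the eigenvector equation at a coordinate of the eigenvector of largest modulus.\<close>

lemma eigenvalue_bound:
  fixes X :: "complex mat"
  assumes X: "X \<in> carrier_mat n n" and b: "\<And>i j. i < n \<Longrightarrow> j < n \<Longrightarrow> cmod (X $$ (i, j)) \<le> b"
    and ev: "eigenvalue X e"
  shows "cmod e \<le> real n * b"
proof -
  obtain v where v: "v \<in> carrier_vec n" "v \<noteq> 0\<^sub>v n" "X *\<^sub>v v = e \<cdot>\<^sub>v v"
    using ev X unfolding eigenvalue_def eigenvector_def by auto
  obtain q where q: "q < n" "v $ q \<noteq> 0" using nonzero_vec_index[OF v(1,2)] .
  have fin: "finite ((\<lambda>i. cmod (v $ i)) ` {..<n})" "(\<lambda>i. cmod (v $ i)) ` {..<n} \<noteq> {}" using q by auto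
  obtain i where i: "i < n" and "cmod (v $ i) = Max ((\<lambda>i. cmod (v $ i)) ` {..<n})"
    using Max_in[OF fin] by auto
  then have mx: "cmod (v $ j) \<le> cmod (v $ i)" if "j < n" for j
    using that fin by simp
  have vi: "0 < cmod (v $ i)" using mx[OF q(1)] q(2) by (metis norm_le_zero_iff not_less order_trans)
  have "e * v $ i = (\<Sum>j = 0..<n. X $$ (i, j) * v $ j)"
    using arg_cong[OF v(3), of "\<lambda>w. w $ i"] X v(1) i by (simp add: scalar_prod_def row_def)
  then have "cmod e * cmod (v $ i) = cmod (\<Sum>j = 0..<n. X $$ (i, j) * v $ j)"
    by (metis norm_mult)
  also have "\<dots> \<le> (\<Sum>j = 0..<n. b * cmod (v $ i))"
  proof (rule order_trans[OF norm_sum sum_mono])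
    fix j assume "j \<in> {0..<n}"
    then have "cmod (X $$ (i, j)) * cmod (v $ j) \<le> b * cmod (v $ i)"
      using b[OF i, of j] mx[of j] order_trans[OF norm_ge_zero b[OF i, of j]] by (intro mult_mono) auto
    then show "cmod (X $$ (i, j) * v $ j) \<le> b * cmod (v $ i)" by (simp add: norm_mult)
  qed
  finally have "cmod e * cmod (v $ i) \<le> (real n * b) * cmod (v $ i)" by (simp add: mult.assoc)
  then show ?thesis using vi by simp
qed

text \<open>Bolzano--Weierstrass for finitely many real sequences at once; it is applied to the real and imaginary
parts of the eigenvalues.\<close>

lemma common_convergent_subsequence:
  fixes f :: "'i \<Rightarrow> nat \<Rightarrow> real"
  assumes "finite I" "\<And>i. i \<in> I \<Longrightarrow> Bseq (f i)"
  shows "\<exists>r. strict_mono r \<and> (\<forall>i\<in>I. convergent (\<lambda>m. f i (r m)))"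
  using assms
proof (induction I rule: finite_induct)
  case empty
  then show ?case by (auto intro: strict_mono_id[unfolded id_def])
next
  case (insert a I)
  then obtain r where r: "strict_mono r" "\<forall>i\<in>I. convergent (\<lambda>m. f i (r m))" by auto
  obtain s where s: "strict_mono s" "monoseq (\<lambda>m. f a (r (s m)))"
    using seq_monosub[of "\<lambda>m. f a (r m)"] by auto
  have "Bseq (\<lambda>m. f a (r (s m)))"
    using Bseq_subseq[of "f a" "\<lambda>m. r (s m)"] insert.prems by simp
  then have "convergent (\<lambda>m. f a (r (s m)))" using s(2) by (rule Bseq_monoseq_convergent)
  moreover have "convergent (\<lambda>m. f i (r (s m)))" if "i \<in> I" for i
    using convergent_subseq_convergent[OF bspec[OF r(2) that] s(1)] by (simp add: o_def)
  moreover have "strict_mono (\<lambda>m. r (s m))"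
    using strict_mono_compose[OF r(1) s(1)] by (simp add: o_def)
  ultimately show ?case by (intro exI[of _ "\<lambda>m. r (s m)"]) auto
qed

lemma char_poly_lim:
  assumes "mat_lim n X L"
  shows "(\<lambda>m. poly (char_poly (X m)) z) \<longlonglongrightarrow> poly (char_poly L) z"
proof -
  note c = mat_limD[OF assms]
  have "mat_lim n (\<lambda>m. - (char_matrix (X m) z)) (- (char_matrix L z))"
    unfolding mat_lim_def
  proof (intro conjI allI impI)
    fix i j assume ij: "i < n" "j < n"
    have e: "(- (char_matrix A z)) $$ (i, j) = - (A $$ (i, j) + - z * 1\<^sub>m n $$ (i, j))" if "A \<in> carrier_mat n n" for A
      using that ij by (simp add: char_matrix_def)
    show "(\<lambda>m. (- (char_matrix (X m) z)) $$ (i, j)) \<longlonglongrightarrow> (- (char_matrix L z)) $$ (i, j)"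
      unfolding e[OF c(1)] e[OF c(2)] by (intro tendsto_minus tendsto_add tendsto_const c(3) ij)
  qed (use c in auto)
  from det_lim[OF this] show ?thesis
    by (simp only: char_poly_matrix[OF c(1)] char_poly_matrix[OF c(2)])
qed

lemma poly_prod_linear: "poly (\<Prod>e\<leftarrow>es. [:- e, 1:]) z = (\<Prod>i<length es. z - es ! i)" for z :: complex
proof -
  have "poly (\<Prod>e\<leftarrow>es. [:- e, 1:]) z = prod_list (map (\<lambda>e. z - e) es)"
    by (induction es) (auto simp: algebra_simps)
  also have "map (\<lambda>e. z - e) es = map (\<lambda>i. z - es ! i) [0..<length es]"
    by (intro nth_equalityI) auto
  finally show ?thesis
    using prod.distinct_set_conv_list[of "[0..<length es]" "\<lambda>i. z - es ! i"] by (simp add: atLeast0LessThan)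
qed

text \<open>The eigenvalues, listed by decreasing modulus, stay bounded, so along a subsequence each entry of the list
converges.  The limits are the roots of the limit of the characteristic polynomials, and they are still
listed by decreasing modulus.  A subsequence is enough to pass to the limit in an inequality.\<close>

lemma top_prod_lim_subseq:
  assumes X: "mat_lim n X L" and k: "k \<le> n"
  obtains r where "strict_mono r" "(\<lambda>m. top_prod k (X (r m))) \<longlonglongrightarrow> top_prod k L"
proof -
  note c = mat_limD[OF X]
  have "\<forall>m. \<exists>es. char_poly (X m) = (\<Prod>e\<leftarrow>es. [:- e, 1:]) \<and> length es = n
     \<and> sorted_wrt (\<lambda>a b. cmod b \<le> cmod a) es"
    using sorted_eigenvalue_list[OF c(1)] by metis
  then obtain es where es: "\<And>m. char_poly (X m) = (\<Prod>e\<leftarrow>es m. [:- e, 1:])" "\<And>m. length (es m) = n"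
    "\<And>m. sorted_wrt (\<lambda>a b. cmod b \<le> cmod a) (es m)" by metis
  have "\<exists>B. \<forall>i<n. \<forall>j<n. \<forall>m. cmod (X m $$ (i, j)) \<le> B"
  proof -
    have "\<forall>p\<in>{..<n} \<times> {..<n}. \<exists>B. \<forall>m. cmod (X m $$ p) \<le> B"
    proof
      fix p assume "p \<in> {..<n} \<times> {..<n}"
      then obtain i j where p: "p = (i, j)" "i < n" "j < n" by auto
      have "Bseq (\<lambda>m. X m $$ p)"
        unfolding p(1) using c(3)[OF p(2,3)] by (intro convergent_imp_Bseq convergentI)
      then show "\<exists>B. \<forall>m. cmod (X m $$ p) \<le> B" by (auto simp: Bseq_def)
    qed
    then obtain B where B: "\<And>p m. p \<in> {..<n} \<times> {..<n} \<Longrightarrow> cmod (X m $$ p) \<le> B p" by metis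
    have "cmod (X m $$ (i, j)) \<le> (\<Sum>p\<in>{..<n} \<times> {..<n}. \<bar>B p\<bar>)" if "i < n" "j < n" for i j m
    proof -
      have "cmod (X m $$ (i, j)) \<le> \<bar>B (i, j)\<bar>" using B[of "(i, j)" m] that by auto
      also have "\<dots> \<le> (\<Sum>p\<in>{..<n} \<times> {..<n}. \<bar>B p\<bar>)"
        using that by (intro member_le_sum) auto
      finally show ?thesis .
    qed
    then show ?thesis by blast
  qed
  then obtain B where B: "\<And>i j m. i < n \<Longrightarrow> j < n \<Longrightarrow> cmod (X m $$ (i, j)) \<le> B" by blast
  have eb: "cmod (es m ! i) \<le> real n * B" if "i < n" for i m
  proof (rule eigenvalue_bound[OF c(1)[of m] B])
    show "eigenvalue (X m) (es m ! i)"
      unfolding eigenvalue_root_char_poly[OF c(1)] es(1) poly_prod_linear using es(2) that by auto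
  qed
  define f where "f = (\<lambda>(i, b) m. if b then Re (es m ! i) else Im (es m ! i))"
  have "\<exists>r. strict_mono r \<and> (\<forall>p\<in>{..<n} \<times> (UNIV :: bool set). convergent (\<lambda>m. f p (r m)))"
  proof (rule common_convergent_subsequence)
    fix p :: "nat \<times> bool" assume "p \<in> {..<n} \<times> UNIV"
    then have "\<bar>f p m\<bar> \<le> real n * B" for m
      using eb[of "fst p" m] abs_Re_le_cmod[of "es m ! fst p"] abs_Im_le_cmod[of "es m ! fst p"]
      by (auto simp: f_def split: prod.splits)
    then show "Bseq (f p)" by (intro BseqI') auto
  qed simp
  then obtain r where r: "strict_mono r"
    and cv: "\<And>i b. i < n \<Longrightarrow> convergent (\<lambda>m. f (i, b) (r m))" by blast
  define l where "l i = Complex (lim (\<lambda>m. f (i, True) (r m))) (lim (\<lambda>m. f (i, False) (r m)))" for i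
  have l: "(\<lambda>m. es (r m) ! i) \<longlonglongrightarrow> l i" if "i < n" for i
  proof (rule tendsto_complex_iff[THEN iffD2], intro conjI)
    show "(\<lambda>m. Re (es (r m) ! i)) \<longlonglongrightarrow> Re (l i)"
      using cv[OF that, of True] by (simp add: l_def convergent_LIMSEQ_iff f_def)
    show "(\<lambda>m. Im (es (r m) ! i)) \<longlonglongrightarrow> Im (l i)"
      using cv[OF that, of False] by (simp add: l_def convergent_LIMSEQ_iff f_def)
  qed
  let ?es = "map l [0..<n]"
  have "poly (char_poly L) z = poly (\<Prod>e\<leftarrow>?es. [:- e, 1:]) z" for z
  proof (rule LIMSEQ_unique)
    show "(\<lambda>m. poly (char_poly (X (r m))) z) \<longlonglongrightarrow> poly (char_poly L) z"
      by (rule char_poly_lim[OF mat_lim_subseq[OF X r]])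
    have "(\<lambda>m. \<Prod>i<n. z - es (r m) ! i) \<longlonglongrightarrow> (\<Prod>i<n. z - l i)"
      by (intro tendsto_prod tendsto_diff tendsto_const l) simp
    then show "(\<lambda>m. poly (char_poly (X (r m))) z) \<longlonglongrightarrow> poly (\<Prod>e\<leftarrow>?es. [:- e, 1:]) z"
      unfolding es(1) poly_prod_linear es(2) by simp
  qed
  then have cp: "char_poly L = (\<Prod>e\<leftarrow>?es. [:- e, 1:])"
    by (simp add: poly_eq_poly_eq_iff[symmetric] fun_eq_iff)
  have "cmod (l j) \<le> cmod (l i)" if "i < j" "j < n" for i j
  proof (rule LIMSEQ_le)
    show "(\<lambda>m. cmod (es (r m) ! j)) \<longlonglongrightarrow> cmod (l j)" using l that by (intro tendsto_norm) auto
    show "(\<lambda>m. cmod (es (r m) ! i)) \<longlonglongrightarrow> cmod (l i)" using l that by (intro tendsto_norm) auto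
    show "\<exists>N. \<forall>m\<ge>N. cmod (es (r m) ! j) \<le> cmod (es (r m) ! i)"
      using es(2,3) that by (auto simp: sorted_wrt_iff_nth_less)
  qed
  then have "sorted_wrt (\<lambda>a b. cmod b \<le> cmod a) ?es" by (simp add: sorted_wrt_iff_nth_less)
  then have "top_prod k L = (\<Prod>i<k. cmod (l i))"
    using top_prod_sorted[OF cp] k by simp
  moreover have "top_prod k (X (r m)) = (\<Prod>i<k. cmod (es (r m) ! i))" for m
    using top_prod_sorted[OF es(1,3)] es(2) k by simp
  moreover have "(\<lambda>m. \<Prod>i<k. cmod (es (r m) ! i)) \<longlonglongrightarrow> (\<Prod>i<k. cmod (l i))"
    using k by (intro tendsto_prod tendsto_norm l) simp
  ultimately show ?thesis using that r by simp
qed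

section \<open>Araki's inequality\<close>

text \<open>Moving a power of \<open>P\<close> from one end of \<open>P\<^sup>m Q\<^sup>m P\<^sup>m\<close> to the other, where \<open>m\<close> is the midpoint of \<open>s\<close>
and \<open>r\<close>, does not change the eigenvalues and gives the product of \<open>P\<^sup>s Q\<^bsup>s/2\<^esup>\<close> and
\<open>Q\<^bsup>r/2\<^esup> P\<^sup>r\<close>.  The Gram matrices of these factors have the eigenvalues of the matrices on the
right-hand side.\<close>

lemma araki_midpoint:
  assumes P: "pd_mat n P" and Q: "pd_mat n Q" and k: "k \<le> n"
  defines "h \<equiv> \<lambda>t. top_prod k (mat_powr P t * mat_powr Q t * mat_powr P t)"
  shows "(h ((s + r) / 2))\<^sup>2 \<le> h s * h r"
proof -
  define m where "m = (s + r) / 2"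
  note as = assoc_mult_mat[of _ n n _ n _ n] mult_carrier_mat[of _ n n _ n] adjoint_mult[of _ n n _ n]
    mat_powr_carrier_pd[OF P] mat_powr_carrier_pd[OF Q]
  define X where "X = mat_powr P s * mat_powr Q (s / 2)"
  define Y where "Y = mat_powr Q (r / 2) * mat_powr P r"
  have X: "X \<in> carrier_mat n n" and Y: "Y \<in> carrier_mat n n" by (simp_all add: X_def Y_def as)
  have cP: "mat_powr P a * (mat_powr P b * Z) = mat_powr P (a + b) * Z"
    and cQ: "mat_powr Q a * (mat_powr Q b * Z) = mat_powr Q (a + b) * Z"
    if "Z \<in> carrier_mat n n" for a b Z
    using that P Q by (simp_all add: mat_powr_add[OF P] mat_powr_add[OF Q] flip: assoc_mult_mat[of _ n n _ n _ n])
  have XY: "X * Y \<in> carrier_mat n n" by (rule mult_carrier_mat[OF X Y])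
  have "mat_powr P (m - s) * (X * Y) * mat_powr P (s - m) = mat_powr P m * mat_powr Q m * mat_powr P m"
  proof -
    have "mat_powr P (r + (s - m)) = mat_powr P m" "mat_powr Q (s / 2 + r / 2) = mat_powr Q m"
      by (simp_all add: m_def field_simps)
    then show ?thesis unfolding X_def Y_def by (simp add: as cP cQ mat_powr_add[OF P])
  qed
  moreover have "mat_powr P (m - s) * mat_powr P (s - m) = 1\<^sub>m n"
    by (simp add: mat_powr_add[OF P] mat_powr_zero[OF pd_imp_psd[OF P]])
  ultimately have "h m = top_prod k (X * Y)"
    unfolding h_def using top_prod_similar[OF XY, of "mat_powr P (m - s)" "mat_powr P (s - m)" k] by (simp add: as)
  then have "(h m)\<^sup>2 \<le> top_prod k (mat_adjoint (X * Y) * (X * Y))"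
    using weyl_product_inequality[OF XY k] by simp
  also have "\<dots> \<le> top_prod k (mat_adjoint X * X) * top_prod k (mat_adjoint Y * Y)"
    by (rule top_prod_gram_mult[OF X Y k])
  also have "mat_adjoint Y * Y = mat_powr P r * mat_powr Q r * mat_powr P r"
    unfolding Y_def by (simp add: as P Q cQ mat_powr_adjoint[OF P] mat_powr_adjoint[OF Q])
  also have "top_prod k (mat_adjoint X * X) = top_prod k (X * mat_adjoint X)"
  proof (rule top_prod_commute[symmetric, OF X])
    show "det X \<noteq> 0" unfolding X_def
      by (simp add: det_mult[of _ n] as det_mat_powr_nonzero[OF P] det_mat_powr_nonzero[OF Q])
  qed (use X in simp)
  also have "X * mat_adjoint X = mat_powr P s * mat_powr Q s * mat_powr P s"
    unfolding X_def by (simp add: as P Q cQ mat_powr_adjoint[OF P] mat_powr_adjoint[OF Q])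
  finally show ?thesis unfolding h_def m_def .
qed

text \<open>A midpoint log-convex function lies below the exponential that interpolates its values at \<open>0\<close> and \<open>1\<close>,
at first at the dyadic points between them.\<close>

lemma dyadic_midpoint_bound:
  fixes h :: "real \<Rightarrow> real"
  assumes mid: "\<And>s r. (h ((s + r) / 2))\<^sup>2 \<le> h s * h r" and nn: "\<And>s. 0 \<le> h s"
    and h0: "h 0 \<le> 1" and h1: "h 1 \<le> c" and c: "0 < c"
  shows "m \<le> 2 ^ j \<Longrightarrow> h (real m / 2 ^ j) \<le> c powr (real m / 2 ^ j)"
proof (induction j arbitrary: m)
  case 0
  then have "m = 0 \<or> m = 1" by auto
  then show ?case using h0 h1 c by auto
next
  case (Suc j)
  show ?case
  proof (cases "even m")
    case True
    then obtain q where q: "m = 2 * q" by auto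
    then have "real m / 2 ^ Suc j = real q / 2 ^ j" by simp
    then show ?thesis using Suc q by simp
  next
    case False
    then obtain q where q: "m = 2 * q + 1" by (elim oddE)
    have le: "q \<le> 2 ^ j" "Suc q \<le> 2 ^ j"
      using Suc.prems q by auto
    have avg: "real m / 2 ^ Suc j = (real q / 2 ^ j + real (Suc q) / 2 ^ j) / 2"
      using q by (simp add: field_simps)
    have "(h (real m / 2 ^ Suc j))\<^sup>2 \<le> h (real q / 2 ^ j) * h (real (Suc q) / 2 ^ j)"
      unfolding avg by (rule mid)
    also have "\<dots> \<le> c powr (real q / 2 ^ j) * c powr (real (Suc q) / 2 ^ j)"
      using Suc.IH[OF le(1)] Suc.IH[OF le(2)] nn by (intro mult_mono) auto
    also have "\<dots> = (c powr (real m / 2 ^ Suc j))\<^sup>2"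
      unfolding avg using c by (simp add: powr_add[symmetric] power2_eq_square)
    finally show ?thesis by (rule power2_le_imp_le) simp
  qed
qed

text \<open>Midpoint log-convexity in \<open>t\<close> gives the inequality for dyadic \<open>t\<close>; the other exponents are limits of
dyadic ones.\<close>

theorem araki_log_majorization:
  assumes P: "pd_mat n P" and Q: "pd_mat n Q" and k: "k \<le> n" and t: "0 \<le> t" "t \<le> 1"
  shows "top_prod k (mat_powr P t * mat_powr Q t * mat_powr P t) \<le> top_prod k (P * Q * P) powr t"
proof -
  define h where "h t = top_prod k (mat_powr P t * mat_powr Q t * mat_powr P t)" for t
  note Pp = pd_imp_psd[OF P] and Qp = pd_imp_psd[OF Q]
  have pd: "pd_mat n (mat_powr P t * mat_powr Q t * mat_powr P t)" for t
    using pd_congruence[OF mat_powr_pd[OF Q], of "mat_powr P t" t] P det_mat_powr_nonzero[OF P, of t] by simp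
  have h1: "h 1 = top_prod k (P * Q * P)" by (simp add: h_def mat_powr_one[OF Pp] mat_powr_one[OF Qp])
  have h0: "h 0 = 1"
  proof -
    have "char_poly (1\<^sub>m n :: complex mat) = (\<Prod>e\<leftarrow>replicate n 1. [:- e, 1:])"
      using char_poly_upper_triangular[of "1\<^sub>m n :: complex mat" n] by simp
    then have "top_prod k (1\<^sub>m n) = (\<Prod>i<k. cmod (replicate n 1 ! i))"
      by (rule top_prod_sorted) (auto simp: sorted_wrt_iff_nth_less k)
    then show ?thesis using k by (simp add: h_def mat_powr_zero[OF Pp] mat_powr_zero[OF Qp])
  qed
  define c where "c = h 1"
  have c: "0 < c" unfolding c_def h_def by (rule top_prod_pos[OF pd k])
  define q where "q m = nat \<lfloor>t * 2 ^ m\<rfloor>" for m :: nat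
  have q: "real (q m) = of_int \<lfloor>t * 2 ^ m\<rfloor>" for m using t by (simp add: q_def)
  have qle: "q m \<le> 2 ^ m" for m
  proof -
    have "real (q m) \<le> t * 2 ^ m" unfolding q by simp
    also have "\<dots> \<le> 1 * 2 ^ m" using t by (intro mult_right_mono) auto
    finally show ?thesis by (metis mult_1 of_nat_le_iff of_nat_numeral of_nat_power)
  qed
  have lim: "(\<lambda>m. real (q m) / 2 ^ m) \<longlonglongrightarrow> t"
  proof (rule tendsto_sandwich)
    show "\<forall>\<^sub>F m in sequentially. t - (1/2) ^ m \<le> real (q m) / 2 ^ m"
    proof (rule always_eventually, rule allI)
      fix m :: nat
      have "t * 2 ^ m - 1 \<le> real (q m)" unfolding q by linarith
      then have "(t * 2 ^ m - 1) / 2 ^ m \<le> real (q m) / 2 ^ m" by (rule divide_right_mono) simp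
      then show "t - (1/2) ^ m \<le> real (q m) / 2 ^ m" by (simp add: diff_divide_distrib power_one_over)
    qed
    show "\<forall>\<^sub>F m in sequentially. real (q m) / 2 ^ m \<le> t"
      unfolding q by (rule always_eventually) (auto simp: field_simps)
    have "(\<lambda>m. t - (1/2) ^ m) \<longlonglongrightarrow> t - 0"
      by (intro tendsto_diff tendsto_const LIMSEQ_power_zero) simp
    then show "(\<lambda>m. t - (1/2) ^ m) \<longlonglongrightarrow> t" by simp
  qed simp
  have "mat_lim n (\<lambda>m. mat_powr P (real (q m) / 2 ^ m) * mat_powr Q (real (q m) / 2 ^ m) * mat_powr P (real (q m) / 2 ^ m))
     (mat_powr P t * mat_powr Q t * mat_powr P t)"
    by (intro mat_lim_mult mat_powr_lim_exponent P Q lim)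
  then obtain r where r: "strict_mono r" "(\<lambda>m. h (real (q (r m)) / 2 ^ r m)) \<longlonglongrightarrow> h t"
    unfolding h_def by (rule top_prod_lim_subseq[OF _ k])
  have "h t \<le> c powr t"
  proof (rule LIMSEQ_le[OF r(2)])
    have "(\<lambda>m. real (q (r m)) / 2 ^ r m) \<longlonglongrightarrow> t"
      using LIMSEQ_subseq_LIMSEQ[OF lim r(1)] by (simp add: o_def)
    then show "(\<lambda>m. c powr (real (q (r m)) / 2 ^ r m)) \<longlonglongrightarrow> c powr t"
      using c by (intro tendsto_powr tendsto_const) auto
    have "h (real m / 2 ^ j) \<le> c powr (real m / 2 ^ j)" if "m \<le> 2 ^ j" for m j
    proof (rule dyadic_midpoint_bound[OF _ _ _ _ c that])
      show "(h ((s + r) / 2))\<^sup>2 \<le> h s * h r" for s r unfolding h_def by (rule araki_midpoint[OF P Q k])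
      show "0 \<le> h s" for s unfolding h_def by (rule top_prod_nonneg[OF pd_carrier[OF pd] k])
    qed (simp_all add: h0 c_def)
    then show "\<exists>N. \<forall>m\<ge>N. h (real (q (r m)) / 2 ^ r m) \<le> c powr (real (q (r m)) / 2 ^ r m)"
      using qle by blast
  qed
  then show ?thesis unfolding c_def h1 by (simp add: h_def)
qed

section \<open>The Loewner order\<close>

definition quad :: "complex mat \<Rightarrow> complex vec \<Rightarrow> real" where
  "quad A v = Re ((A *\<^sub>v v) \<bullet>c v)"

definition loewner_le :: "nat \<Rightarrow> complex mat \<Rightarrow> complex mat \<Rightarrow> bool" where
  "loewner_le n A B \<longleftrightarrow> (\<forall>v\<in>carrier_vec n. quad A v \<le> quad B v)"

lemma quad_congruence:
  assumes "A \<in> carrier_mat n n" "X \<in> carrier_mat n m" "v \<in> carrier_vec m"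
  shows "quad (mat_adjoint X * A * X) v = quad A (X *\<^sub>v v)"
  using quad_form_congruence[OF assms] by (simp add: quad_def)

lemma quad_sandwich:
  assumes "A \<in> carrier_mat n n" "pd_mat n P" "v \<in> carrier_vec n"
  shows "quad (mat_powr P s * A * mat_powr P s) v = quad A (mat_powr P s *\<^sub>v v)"
  using quad_congruence[OF assms(1) mat_powr_carrier_pd[OF assms(2), of s] assms(3)] assms(2) by simp

lemma psd_quad_nonneg: "psd_mat n A \<Longrightarrow> v \<in> carrier_vec n \<Longrightarrow> 0 \<le> quad A v"
  by (simp add: psd_mat_def quad_def)

lemma quad_one: "v \<in> carrier_vec n \<Longrightarrow> quad (1\<^sub>m n) v = (\<Sum>i<n. (cmod (v $ i))\<^sup>2)"
  by (simp add: quad_def inner_self)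

lemma top_prod_one_iff:
  assumes S: "psd_mat n S" and n: "0 < n"
  shows "top_prod 1 S \<le> 1 \<longleftrightarrow> loewner_le n S (1\<^sub>m n)"
proof -
  obtain U d where U: "unitary_mat n U" and SU: "S = U * diag_real n d * mat_adjoint U"
    and d: "\<And>i. i < n \<Longrightarrow> 0 \<le> d i" "\<And>i j. i \<le> j \<Longrightarrow> j < n \<Longrightarrow> d j \<le> d i"
    and tp: "\<And>k. k \<le> n \<Longrightarrow> top_prod k S = (\<Prod>i<k. d i)"
    using psd_spectral[OF S] by metis
  note Uc = unitaryD[OF U]
  have tp1: "top_prod 1 S = d 0" using tp[of 1] n by simp
  have adjU: "mat_adjoint U \<in> carrier_mat n n" using Uc by simp
  have qS: "quad S v = (\<Sum>i<n. d i * (cmod ((mat_adjoint U *\<^sub>v v) $ i))\<^sup>2)" if "v \<in> carrier_vec n" for v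
    using quad_congruence[OF _ adjU that, of "diag_real n d"] that adjU unfolding SU
    by (simp add: quad_def quad_form_diag[of _ n] Re_sum del: of_real_sum flip: of_real_sum)
  have q1: "quad (1\<^sub>m n) v = (\<Sum>i<n. (cmod ((mat_adjoint U *\<^sub>v v) $ i))\<^sup>2)" if "v \<in> carrier_vec n" for v
    using quad_congruence[OF one_carrier_mat adjU that] quad_one[of "mat_adjoint U *\<^sub>v v" n] that Uc by simp
  show ?thesis
  proof
    assume le: "top_prod 1 S \<le> 1"
    have "d i \<le> 1" if "i < n" for i using d(2)[of 0 i] that le tp1 by simp
    then show "loewner_le n S (1\<^sub>m n)"
      unfolding loewner_le_def by (auto simp: qS q1 intro!: sum_mono mult_left_le_one_le d(1))
  next
    assume le: "loewner_le n S (1\<^sub>m n)"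
    define v where "v = U *\<^sub>v unit_vec n 0"
    have v: "v \<in> carrier_vec n" using Uc by (simp add: v_def)
    have "mat_adjoint U *\<^sub>v v = (mat_adjoint U * U) *\<^sub>v unit_vec n 0"
      unfolding v_def by (rule assoc_mult_mat_vec[symmetric, of _ n n _ n]) (use Uc in auto)
    then have e0: "mat_adjoint U *\<^sub>v v = unit_vec n 0" using Uc by simp
    have delta: "(\<Sum>i<n. f i * (cmod ((unit_vec n 0 :: complex vec) $ i))\<^sup>2) = f 0" for f :: "nat \<Rightarrow> real"
    proof -
      have "(\<Sum>i<n. f i * (cmod ((unit_vec n 0 :: complex vec) $ i))\<^sup>2) = (\<Sum>i<n. if i = 0 then f i else 0)"
        using n by (intro sum.cong) auto
      then show ?thesis using n by simp
    qed
    have "quad S v = d 0" unfolding qS[OF v] e0 by (rule delta)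
    moreover have "quad (1\<^sub>m n) v = 1" unfolding q1[OF v] e0 using delta[of "\<lambda>_. 1"] by (simp only: mult_1)
    ultimately show "top_prod 1 S \<le> 1" using le v tp1 unfolding loewner_le_def by metis
  qed
qed

text \<open>By \<open>top_prod_one_iff\<close>, the hypothesis says that \<open>Z\<^bsup>-1/2\<^esup> X Z\<^bsup>-1/2\<^esup>\<close> has no eigenvalue above \<open>1\<close>, and
the conclusion says the same about \<open>Z\<^bsup>-t/2\<^esup> X\<^sup>t Z\<^bsup>-t/2\<^esup>\<close>.  Araki's inequality with
\<open>P = Z\<^bsup>-1/2\<^esup>\<close> and \<open>k = 1\<close> leads from the one to the other.\<close>

theorem loewner_heinz:
  assumes X: "pd_mat n X" and Z: "pd_mat n Z" and le: "loewner_le n X Z" and t: "0 \<le> t" "t \<le> 1"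
  shows "loewner_le n (mat_powr X t) (mat_powr Z t)"
proof (cases "n = 0")
  case True
  then show ?thesis using X Z by (auto simp: loewner_le_def quad_def scalar_prod_def)
next
  case False
  then have n: "0 < n" by simp
  define P where "P = mat_powr Z (- 1 / 2)"
  have P: "pd_mat n P" unfolding P_def by (rule mat_powr_pd[OF Z])
  have Pt: "mat_powr P s = mat_powr Z (- s / 2)" for s unfolding P_def by (simp add: mat_powr_powr[OF Z])
  have P1: "mat_powr P 1 = P" by (rule mat_powr_one[OF pd_imp_psd[OF P]])
  have inv: "mat_powr Z a * mat_powr Z b * mat_powr Z a = mat_powr Z (a + b + a)" for a b
    by (simp add: mat_powr_add[OF Z])
  have sand: "pd_mat n (mat_powr P s * Y * mat_powr P s)" if "pd_mat n Y" for s Y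
    using pd_congruence[OF that mat_powr_carrier_pd[OF P, of s] det_mat_powr_nonzero[OF P]] P by simp
  have "loewner_le n (P * X * P) (1\<^sub>m n)"
  proof -
    have "P * Z * P = 1\<^sub>m n"
      using inv[of "- 1 / 2" 1] mat_powr_one[OF pd_imp_psd[OF Z]] mat_powr_zero[OF pd_imp_psd[OF Z]]
      by (simp add: P_def)
    moreover have "quad (P * X * P) v \<le> quad (P * Z * P) v" if v: "v \<in> carrier_vec n" for v
      using quad_sandwich[OF pd_carrier[OF X] P v, of 1] quad_sandwich[OF pd_carrier[OF Z] P v, of 1] le pd_carrier[OF P] v
      by (simp add: P1 loewner_le_def)
    ultimately show ?thesis by (simp add: loewner_le_def)
  qed
  then have tp: "top_prod 1 (P * X * P) \<le> 1"
    using top_prod_one_iff[OF pd_imp_psd[OF sand[OF X, of 1]] n] by (simp add: P1)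
  have "top_prod 1 (mat_powr P t * mat_powr X t * mat_powr P t) \<le> top_prod 1 (P * X * P) powr t"
    by (rule araki_log_majorization[OF P X _ t]) (use n in simp)
  also have "\<dots> \<le> 1 powr t"
    using tp top_prod_pos[OF sand[OF X, of 1], of 1] n t by (intro powr_mono2) (simp_all add: P1)
  finally have le1: "loewner_le n (mat_powr P t * mat_powr X t * mat_powr P t) (1\<^sub>m n)"
    using top_prod_one_iff[OF pd_imp_psd[OF sand[OF mat_powr_pd[OF X]]] n] by simp
  show ?thesis unfolding loewner_le_def
  proof
    fix v :: "complex vec" assume v: "v \<in> carrier_vec n"
    define w where "w = mat_powr Z (t / 2) *\<^sub>v v"
    have w: "w \<in> carrier_vec n" unfolding w_def using v mat_powr_carrier_pd[OF Z, of "t / 2"] by simp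
    have "mat_powr P t *\<^sub>v w = (mat_powr Z (- t / 2) * mat_powr Z (t / 2)) *\<^sub>v v"
      unfolding w_def Pt by (rule assoc_mult_mat_vec[symmetric, of _ n n _ n]) (use Z v in auto)
    also have "\<dots> = v" using v by (simp add: mat_powr_add[OF Z] mat_powr_zero[OF pd_imp_psd[OF Z]])
    finally have "quad (mat_powr X t) v = quad (mat_powr P t * mat_powr X t * mat_powr P t) w"
      using quad_sandwich[OF mat_powr_carrier_pd[OF X] P w] by simp
    also have "\<dots> \<le> quad (1\<^sub>m n) w" using le1 w by (simp add: loewner_le_def)
    also have "\<dots> = quad (mat_powr Z (t / 2) * 1\<^sub>m n * mat_powr Z (t / 2)) v"
      unfolding w_def using quad_sandwich[OF one_carrier_mat Z v] by simp
    also have "\<dots> = quad (mat_powr Z t) v"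
      using Z by (simp add: mat_powr_add[OF Z] right_mult_one_mat[OF mat_powr_carrier_pd[OF Z]])
    finally show "quad (mat_powr X t) v \<le> quad (mat_powr Z t) v" .
  qed
qed

section \<open>The weighted geometric mean of positive definite matrices\<close>

text \<open>The geometric mean may be computed from any simultaneous diagonalisation of \<open>A\<close> and \<open>B\<close> by congruence,
because \<open>A\<^bsup>-1/2\<^esup> S\<close> is unitary when \<open>A = S S\<^sup>*\<close>.\<close>

lemma geom_mean_pd_factorised:
  assumes S: "S \<in> carrier_mat n n" and A: "pd_mat n A" "A = S * mat_adjoint S"
    and B: "B = S * diag_real n d * mat_adjoint S" and d: "\<And>i. i < n \<Longrightarrow> 0 < d i"
  shows "geom_mean_pd t A B = S * diag_real n (\<lambda>i. d i powr t) * mat_adjoint S"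
proof -
  let ?H = "mat_powr A (1/2)" and ?H' = "mat_powr A (- 1 / 2)"
  note as = assoc_mult_mat[of _ n n _ n _ n] mult_carrier_mat[of _ n n _ n] adjoint_mult[of _ n n _ n]
    mat_powr_carrier_pd[OF A(1)] mat_powr_adjoint[OF A(1)]
  have c: "mat_powr A a * (mat_powr A b * Z) = mat_powr A (a + b) * Z" if "Z \<in> carrier_mat n n" for a b Z
    using that A(1) by (simp add: mat_powr_add[OF A(1)] flip: assoc_mult_mat[of _ n n _ n _ n])
  note z = mat_powr_zero[OF pd_imp_psd[OF A(1)]]
  define W where "W = ?H' * S"
  have W: "W \<in> carrier_mat n n" using S by (simp add: W_def as)
  have "W * mat_adjoint W = ?H' * (S * mat_adjoint S) * ?H'"
    unfolding W_def using S by (simp add: as)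
  also have "\<dots> = ?H' * mat_powr A 1 * ?H'"
    using A mat_powr_one[OF pd_imp_psd[OF A(1)]] by simp
  also have "\<dots> = 1\<^sub>m n" by (simp add: mat_powr_add[OF A(1)] z)
  finally have "mat_adjoint W * W = 1\<^sub>m n"
    using mat_mult_left_right_inverse[of W n "mat_adjoint W"] W by simp
  then have Wu: "unitary_mat n W" using W by (simp add: unitary_mat_def)
  have "?H' * B * ?H' = W * diag_real n d * mat_adjoint W"
    unfolding W_def B using S by (simp add: as)
  then have "mat_powr (?H' * B * ?H') t = W * diag_real n (\<lambda>i. d i powr t) * mat_adjoint W"
    using d by (intro mat_powr_pd_diagonalised[OF Wu])
  then have "geom_mean_pd t A B = ?H * (W * diag_real n (\<lambda>i. d i powr t) * mat_adjoint W) * ?H"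
    unfolding geom_mean_pd_def by simp
  also have "\<dots> = S * diag_real n (\<lambda>i. d i powr t) * (mat_adjoint S * (?H' * ?H))"
    unfolding W_def using S by (simp add: as c z)
  also have "\<dots> = S * diag_real n (\<lambda>i. d i powr t) * mat_adjoint S"
    using S by (simp add: mat_powr_add[OF A(1)] z)
  finally show ?thesis .
qed

lemma pd_pair_factorised:
  assumes A: "pd_mat n A" and B: "pd_mat n B"
  obtains S d where "S \<in> carrier_mat n n" "det S \<noteq> 0" "A = S * mat_adjoint S"
    "B = S * diag_real n d * mat_adjoint S" "\<And>i. i < n \<Longrightarrow> 0 < d i"
proof -
  let ?H = "mat_powr A (1/2)" and ?H' = "mat_powr A (- 1 / 2)"
  note as = assoc_mult_mat[of _ n n _ n _ n] mult_carrier_mat[of _ n n _ n] adjoint_mult[of _ n n _ n]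
    mat_powr_carrier_pd[OF A] mat_powr_adjoint[OF A]
  have c: "mat_powr A a * (mat_powr A b * Z) = mat_powr A (a + b) * Z" if "Z \<in> carrier_mat n n" for a b Z
    using that A by (simp add: mat_powr_add[OF A] flip: assoc_mult_mat[of _ n n _ n _ n])
  note z = mat_powr_zero[OF pd_imp_psd[OF A]]
  have "pd_mat n (?H' * B * ?H')"
    using pd_congruence[OF B mat_powr_carrier_pd[OF A, of "- 1 / 2"] det_mat_powr_nonzero[OF A]] A by simp
  then obtain U d where U: "unitary_mat n U" and C: "?H' * B * ?H' = U * diag_real n d * mat_adjoint U"
    and d: "\<And>i. i < n \<Longrightarrow> 0 < d i" using pd_spectral by metis
  note Uc = unitaryD[OF U]
  define S where "S = ?H * U"
  have S: "S \<in> carrier_mat n n" using Uc by (simp add: S_def as)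
  have "det S \<noteq> 0"
    unfolding S_def using Uc(1) det_mat_powr_nonzero[OF A, of "1/2"] cmod_det_unitary(1)[OF U]
    by (auto simp: det_mult[of _ n] as)
  moreover have "S * mat_adjoint S = A"
    unfolding S_def using Uc mat_powr_one[OF pd_imp_psd[OF A]] by (simp add: as unitary_cancel[OF U, of _ n] mat_powr_add[OF A])
  moreover have "S * diag_real n d * mat_adjoint S = ?H * (U * diag_real n d * mat_adjoint U) * ?H"
    unfolding S_def using Uc(1) by (simp add: as)
  moreover have "\<dots> = B"
    unfolding C[symmetric] using pd_carrier[OF B] by (simp add: as c z mat_powr_add[OF A])
  ultimately show ?thesis using that[of S d] S d by simp
qed

lemma geom_mean_pd_pd:
  assumes A: "pd_mat n A" and B: "pd_mat n B"
  shows "pd_mat n (geom_mean_pd t A B)"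
proof -
  have "pd_mat n (mat_powr A (- 1 / 2) * B * mat_powr A (- 1 / 2))"
    using pd_congruence[OF B mat_powr_carrier_pd[OF A, of "- 1 / 2"] det_mat_powr_nonzero[OF A]] A by simp
  then show ?thesis unfolding geom_mean_pd_def
    using pd_congruence[OF mat_powr_pd mat_powr_carrier_pd[OF A, of "1 / 2"] det_mat_powr_nonzero[OF A]] A by simp
qed

text \<open>Rescaling the columns of \<open>S\<close> by the square roots of the diagonal entries \<open>d\<close> exchanges the roles of \<open>A\<close>
and \<open>B\<close> in their simultaneous diagonalisation and inverts the diagonal.\<close>

lemma geom_mean_pd_commute:
  assumes A: "pd_mat n A" and B: "pd_mat n B"
  shows "geom_mean_pd t A B = geom_mean_pd (1 - t) B A"
proof -
  obtain S d where S: "S \<in> carrier_mat n n" and AS: "A = S * mat_adjoint S"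
    and BS: "B = S * diag_real n d * mat_adjoint S" and d: "\<And>i. i < n \<Longrightarrow> 0 < d i"
    using pd_pair_factorised[OF A B] by metis
  note as = assoc_mult_mat[of _ n n _ n _ n] mult_carrier_mat[of _ n n _ n] adjoint_mult[of _ n n _ n]
  define R where "R = S * diag_real n (\<lambda>i. sqrt (d i))"
  have R: "R \<in> carrier_mat n n" using S by (simp add: R_def as)
  have RR: "R * diag_real n f * mat_adjoint R = S * diag_real n (\<lambda>i. d i * f i) * mat_adjoint S" for f
  proof -
    have "R * diag_real n f * mat_adjoint R
        = S * (diag_real n (\<lambda>i. sqrt (d i)) * (diag_real n f * diag_real n (\<lambda>i. sqrt (d i)))) * mat_adjoint S"
      unfolding R_def using S by (simp add: as del: mat_diag_diag)
    also have "diag_real n (\<lambda>i. sqrt (d i)) * (diag_real n f * diag_real n (\<lambda>i. sqrt (d i))) = diag_real n (\<lambda>i. d i * f i)"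
      unfolding mat_diag_diag
    proof (rule mat_diag_cong)
      fix i assume "i < n"
      then have "sqrt (d i) * (f i * sqrt (d i)) = d i * f i" using d[of i] by simp
      then show "complex_of_real (sqrt (d i)) * (complex_of_real (f i) * complex_of_real (sqrt (d i))) = complex_of_real (d i * f i)"
        by (metis of_real_mult)
    qed
    finally show ?thesis .
  qed
  have "B = R * mat_adjoint R"
    using RR[of "\<lambda>_. 1"] R by (simp add: BS)
  moreover have "A = R * diag_real n (\<lambda>i. 1 / d i) * mat_adjoint R"
  proof -
    have "diag_real n (\<lambda>i. d i * (1 / d i)) = mat_diag n (\<lambda>i. 1)"
      by (rule mat_diag_cong) (use d in force)
    then show ?thesis unfolding RR AS using S by simp
  qed
  ultimately have "geom_mean_pd (1 - t) B A = R * diag_real n (\<lambda>i. (1 / d i) powr (1 - t)) * mat_adjoint R"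
    using d by (intro geom_mean_pd_factorised[OF R B]) auto
  also have "\<dots> = S * diag_real n (\<lambda>i. d i powr t) * mat_adjoint S"
  proof -
    have "d i * (1 / d i) powr (1 - t) = d i powr t" if "i < n" for i
    proof -
      have "(1 / d i) powr (1 - t) = d i powr (t - 1)"
        using d[OF that] powr_minus_divide[of "d i" "1 - t"] by (simp add: powr_divide)
      then show ?thesis using d[OF that] powr_add[of "d i" 1 "t - 1"] by simp
    qed
    then have "diag_real n (\<lambda>i. d i * (1 / d i) powr (1 - t)) = diag_real n (\<lambda>i. d i powr t)"
      by (intro mat_diag_cong) (simp only:)
    then show ?thesis unfolding RR by simp
  qed
  also have "\<dots> = geom_mean_pd t A B"
    by (rule geom_mean_pd_factorised[OF S A AS BS d, symmetric])
  finally show ?thesis by simp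
qed

lemma loewner_le_sandwich:
  assumes "loewner_le n A B" "A \<in> carrier_mat n n" "B \<in> carrier_mat n n" "pd_mat n P"
  shows "loewner_le n (mat_powr P s * A * mat_powr P s) (mat_powr P s * B * mat_powr P s)"
  unfolding loewner_le_def
proof
  fix v :: "complex vec" assume v: "v \<in> carrier_vec n"
  have "mat_powr P s *\<^sub>v v \<in> carrier_vec n" using v mat_powr_carrier_pd[OF assms(4), of s] by simp
  then show "quad (mat_powr P s * A * mat_powr P s) v \<le> quad (mat_powr P s * B * mat_powr P s) v"
    using assms(1) by (simp add: quad_sandwich[OF assms(2,4) v] quad_sandwich[OF assms(3,4) v] loewner_le_def)
qed

lemma pd_sandwich:
  assumes "pd_mat n P" "pd_mat n A"
  shows "pd_mat n (mat_powr P s * A * mat_powr P s)"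
  using pd_congruence[OF assms(2) mat_powr_carrier_pd[OF assms(1), of s] det_mat_powr_nonzero[OF assms(1)]] assms(1)
  by simp

lemma geom_mean_pd_mono_right:
  assumes A: "pd_mat n A" and B: "pd_mat n B" "pd_mat n B'" "loewner_le n B B'" and t: "0 \<le> t" "t \<le> 1"
  shows "loewner_le n (geom_mean_pd t A B) (geom_mean_pd t A B')"
  unfolding geom_mean_pd_def
  by (intro loewner_le_sandwich loewner_heinz pd_sandwich pd_carrier[OF B(1)] pd_carrier[OF B(2)]
      mat_powr_carrier_pd A B t)

text \<open>Monotonicity in the second argument is the Loewner--Heinz inequality.  The symmetry of the mean transfers
it to the first argument.\<close>

lemma geom_mean_pd_mono:
  assumes A: "pd_mat n A" "pd_mat n A'" "loewner_le n A A'"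
    and B: "pd_mat n B" "pd_mat n B'" "loewner_le n B B'" and t: "0 \<le> t" "t \<le> 1"
  shows "loewner_le n (geom_mean_pd t A B) (geom_mean_pd t A' B')"
proof -
  have "loewner_le n (geom_mean_pd t A B) (geom_mean_pd t A B')"
    by (rule geom_mean_pd_mono_right[OF A(1) B t])
  moreover have "loewner_le n (geom_mean_pd t A B') (geom_mean_pd t A' B')"
    unfolding geom_mean_pd_commute[OF A(1) B(2)] geom_mean_pd_commute[OF A(2) B(2)]
    by (rule geom_mean_pd_mono_right[OF B(2) A]) (use t in auto)
  ultimately show ?thesis unfolding loewner_le_def by (meson order_trans)
qed

section \<open>The inequality for positive definite matrices\<close>

text \<open>The matrix on the left is \<open>A\<^sup>t C\<^sup>t A\<^sup>t\<close> with \<open>C = A\<^bsup>-1/2\<^esup> B A\<^bsup>-1/2\<^esup>\<close>, to which Araki's inequality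
applies; \<open>A C A = A\<^bsup>1/2\<^esup> B A\<^bsup>1/2\<^esup>\<close> has the eigenvalues of \<open>A B\<close>.\<close>

lemma top_prod_compressed_geom_mean:
  assumes A: "pd_mat n A" and B: "pd_mat n B" and k: "k \<le> n" and t: "0 \<le> t" "t \<le> 1"
  shows "top_prod k (mat_powr A (t - 1/2) * geom_mean_pd t A B * mat_powr A (t - 1/2)) \<le> top_prod k (A * B) powr t"
proof -
  define C where "C = mat_powr A (- 1 / 2) * B * mat_powr A (- 1 / 2)"
  have C: "pd_mat n C" unfolding C_def by (rule pd_sandwich[OF A B])
  note as = assoc_mult_mat[of _ n n _ n _ n] mult_carrier_mat[of _ n n _ n]
    mat_powr_carrier_pd[OF A] mat_powr_carrier_pd[OF C] pd_carrier[OF B]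
  have c: "mat_powr A a * (mat_powr A b * Z) = mat_powr A (a + b) * Z" if "Z \<in> carrier_mat n n" for a b Z
    using that A by (simp add: mat_powr_add[OF A] flip: assoc_mult_mat[of _ n n _ n _ n])
  note z = mat_powr_zero[OF pd_imp_psd[OF A]] and o = mat_powr_one[OF pd_imp_psd[OF A]]
  have "mat_powr A (t - 1/2) * geom_mean_pd t A B * mat_powr A (t - 1/2) = mat_powr A t * mat_powr C t * mat_powr A t"
    unfolding geom_mean_pd_def C_def[symmetric] by (simp add: as c mat_powr_add[OF A])
  then have "top_prod k (mat_powr A (t - 1/2) * geom_mean_pd t A B * mat_powr A (t - 1/2)) \<le> top_prod k (A * C * A) powr t"
    using araki_log_majorization[OF A C k t] by simp
  also have "A * C * A = mat_powr A 1 * C * mat_powr A 1" by (simp add: o)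
  also have "\<dots> = mat_powr A (1/2) * (B * mat_powr A (1/2))"
    unfolding C_def by (simp add: as c mat_powr_add[OF A])
  also have "top_prod k \<dots> = top_prod k (B * mat_powr A (1/2) * mat_powr A (1/2))"
    by (rule top_prod_commute[where n = n]) (simp_all add: as det_mat_powr_nonzero[OF A])
  also have "B * mat_powr A (1/2) * mat_powr A (1/2) = B * A"
    by (simp add: as mat_powr_add[OF A] o)
  also have "top_prod k (B * A) = top_prod k (A * B)"
    by (rule top_prod_commute[where n = n]) (simp_all add: pd_carrier[OF A] pd_carrier[OF B] det_pd_nonzero[OF B])
  finally show ?thesis .
qed

theorem pd_log_majorization:
  assumes A: "pd_mat n A" and B: "pd_mat n B" and k: "k \<le> n" and t: "0 \<le> t" "t \<le> 1"
  shows "top_prod k (mat_powr A t * geom_mean_pd t A B * mat_powr B (1 - t)) \<le> top_prod k (A * B)"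
proof -
  define Y where "Y = geom_mean_pd t A B"
  have Y: "pd_mat n Y" unfolding Y_def by (rule geom_mean_pd_pd[OF A B])
  note as = assoc_mult_mat[of _ n n _ n _ n] mult_carrier_mat[of _ n n _ n] adjoint_mult[of _ n n _ n]
    mat_powr_carrier_pd[OF A] mat_powr_carrier_pd[OF B] mat_powr_carrier_pd[OF Y]
    pd_carrier[OF A] pd_carrier[OF B] pd_carrier[OF Y]
    mat_powr_adjoint[OF A] mat_powr_adjoint[OF B] mat_powr_adjoint[OF Y]
  have cA: "mat_powr A a * (mat_powr A b * Z) = mat_powr A (a + b) * Z"
    and cB: "mat_powr B a * (mat_powr B b * Z) = mat_powr B (a + b) * Z"
    and cY: "mat_powr Y a * (mat_powr Y b * Z) = mat_powr Y (a + b) * Z" if "Z \<in> carrier_mat n n" for a b Z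
    using that A B Y by (simp_all add: mat_powr_add[OF A] mat_powr_add[OF B] mat_powr_add[OF Y] flip: assoc_mult_mat[of _ n n _ n _ n])
  note oA = mat_powr_one[OF pd_imp_psd[OF A]] and oB = mat_powr_one[OF pd_imp_psd[OF B]]
    and oY = mat_powr_one[OF pd_imp_psd[OF Y]]
  define p where "p = top_prod k (A * B)"
  have p: "0 \<le> p" unfolding p_def by (rule top_prod_nonneg[OF _ k]) (simp add: as)
  \<comment> \<open>Splitting the mean symmetrically lets \<open>E\<close> be bounded in terms of \<open>A\<close>, and \<open>F\<close> in terms of \<open>B\<close>.\<close>
  define E where "E = mat_powr A (t - 1/2) * mat_powr Y (1/2)"
  define F where "F = mat_powr Y (1/2) * mat_powr B (1/2 - t)"
  define H where "H = mat_powr B (1/2) * mat_powr A (1/2)"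
  have E: "E \<in> carrier_mat n n" and F: "F \<in> carrier_mat n n" and H: "H \<in> carrier_mat n n"
    by (simp_all add: E_def F_def H_def as)
  have EF: "E * F \<in> carrier_mat n n" by (rule mult_carrier_mat[OF E F])
  have EFH: "E * F * H \<in> carrier_mat n n" by (rule mult_carrier_mat[OF EF H])
  have "mat_powr A (1/2) * (E * F * H) * mat_powr A (- 1 / 2) = mat_powr A t * Y * mat_powr B (1 - t)"
    unfolding E_def F_def H_def
    by (simp add: as cA cB cY mat_powr_add[OF A] mat_powr_zero[OF pd_imp_psd[OF A]] oY right_mult_one_mat[of _ n n])
  moreover have "mat_powr A (1/2) * mat_powr A (- 1 / 2) = 1\<^sub>m n"
    by (simp add: mat_powr_add[OF A] mat_powr_zero[OF pd_imp_psd[OF A]])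
  ultimately have tp: "top_prod k (mat_powr A t * Y * mat_powr B (1 - t)) = top_prod k (E * F * H)"
    using top_prod_similar[OF EFH, of "mat_powr A (1/2)" "mat_powr A (- 1 / 2)" k] by (simp add: as)
  have "(top_prod k (E * F * H))\<^sup>2 \<le> top_prod k (mat_adjoint (E * F * H) * (E * F * H))"
    by (rule weyl_product_inequality[OF EFH k])
  also have "\<dots> \<le> top_prod k (mat_adjoint (E * F) * (E * F)) * top_prod k (mat_adjoint H * H)"
    by (rule top_prod_gram_mult[OF EF H k])
  also have "\<dots> \<le> (top_prod k (mat_adjoint E * E) * top_prod k (mat_adjoint F * F)) * top_prod k (mat_adjoint H * H)"
    by (intro mult_right_mono top_prod_gram_mult[OF E F k] top_prod_nonneg[OF _ k]) (use H in \<open>simp add: as\<close>)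
  also have "top_prod k (mat_adjoint H * H) = p"
  proof -
    have "mat_adjoint H * H = mat_powr A (1/2) * (B * mat_powr A (1/2))"
      unfolding H_def by (simp add: as cB oB)
    also have "top_prod k \<dots> = top_prod k (B * mat_powr A (1/2) * mat_powr A (1/2))"
      by (rule top_prod_commute[where n = n]) (simp_all add: as det_mat_powr_nonzero[OF A])
    also have "B * mat_powr A (1/2) * mat_powr A (1/2) = B * A"
      by (simp add: as mat_powr_add[OF A] oA)
    also have "top_prod k (B * A) = p"
      unfolding p_def by (rule top_prod_commute[where n = n]) (simp_all add: as det_pd_nonzero[OF B])
    finally show ?thesis .
  qed
  also have "(top_prod k (mat_adjoint E * E) * top_prod k (mat_adjoint F * F)) * p \<le> (p powr t * p powr (1 - t)) * p"
  proof (intro mult_right_mono mult_mono p)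
    have "top_prod k (mat_adjoint E * E) = top_prod k (E * mat_adjoint E)"
    proof (rule top_prod_commute[symmetric, OF E])
      show "det E \<noteq> 0" unfolding E_def
        by (simp add: det_mult[of _ n] as det_mat_powr_nonzero[OF A] det_mat_powr_nonzero[OF Y])
    qed (use E in simp)
    also have "E * mat_adjoint E = mat_powr A (t - 1/2) * geom_mean_pd t A B * mat_powr A (t - 1/2)"
      unfolding E_def Y_def[symmetric] by (simp add: as cY oY)
    also have "top_prod k \<dots> \<le> p powr t"
      unfolding p_def by (rule top_prod_compressed_geom_mean[OF A B k t])
    finally show "top_prod k (mat_adjoint E * E) \<le> p powr t" .
    have "mat_adjoint F * F = mat_powr B (1 - t - 1/2) * geom_mean_pd (1 - t) B A * mat_powr B (1 - t - 1/2)"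
      unfolding F_def geom_mean_pd_commute[OF A B, symmetric] Y_def[symmetric] by (simp add: as cY oY)
    then have "top_prod k (mat_adjoint F * F) \<le> top_prod k (B * A) powr (1 - t)"
      using top_prod_compressed_geom_mean[OF B A k, of "1 - t"] t by simp
    also have "top_prod k (B * A) = p"
      unfolding p_def by (rule top_prod_commute[where n = n]) (simp_all add: as det_pd_nonzero[OF B])
    finally show "top_prod k (mat_adjoint F * F) \<le> p powr (1 - t)" .
  qed (use F k in \<open>auto intro!: top_prod_nonneg[of _ n] simp: as\<close>)
  also have "\<dots> = p\<^sup>2"
    using p by (cases "p = 0") (simp_all add: power2_eq_square flip: powr_add)
  finally have "top_prod k (E * F * H) \<le> p" using p by (rule power2_le_imp_le)
  then show ?thesis unfolding Y_def[symmetric] tp p_def .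
qed

lemma cmod_det_pd_product:
  assumes A: "pd_mat n A" and B: "pd_mat n B"
  shows "cmod (det (mat_powr A t * geom_mean_pd t A B * mat_powr B (1 - t))) = cmod (det (A * B))"
proof -
  define C where "C = mat_powr A (- 1 / 2) * B * mat_powr A (- 1 / 2)"
  have C: "pd_mat n C" unfolding C_def by (rule pd_sandwich[OF A B])
  define a b where "a = cmod (det A)" and "b = cmod (det B)"
  have ab: "0 < a" "0 < b" using det_pd_nonzero[OF A] det_pd_nonzero[OF B] by (simp_all add: a_def b_def)
  note m = cmod_det_mult[of _ n] mult_carrier_mat[of _ n n _ n] mat_powr_carrier_pd[OF A] mat_powr_carrier_pd[OF B]
    mat_powr_carrier_pd[OF C] pd_carrier[OF A] pd_carrier[OF B]
    cmod_det_mat_powr[OF A, folded a_def] cmod_det_mat_powr[OF B, folded b_def] cmod_det_mat_powr[OF C]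
  have "cmod (det C) = a powr (- 1 / 2) * b * a powr (- 1 / 2)"
    unfolding C_def by (simp add: m flip: b_def)
  also have "\<dots> = a powr (- 1) * b" using powr_add[of a "- 1 / 2" "- 1 / 2"] by simp
  finally have dC: "cmod (det C) = a powr (- 1) * b" .
  have "cmod (det (mat_powr A t * geom_mean_pd t A B * mat_powr B (1 - t)))
     = a powr t * (a powr (1/2) * (a powr (- 1) * b) powr t * a powr (1/2)) * b powr (1 - t)"
    unfolding geom_mean_pd_def C_def[symmetric] by (simp add: m dC)
  also have "\<dots> = (a powr t * a powr (1/2) * a powr (- t) * a powr (1/2)) * (b powr t * b powr (1 - t))"
  proof -
    have "(x * y) powr t = x powr t * y powr t" if "0 < x" "0 < y" for x y :: real
      using that by (simp add: powr_mult)
    from this[of "a powr (- 1)" b] have "(a powr (- 1) * b) powr t = a powr (- t) * b powr t"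
      using ab by (simp only: powr_powr mult_minus1 powr_gt_zero)
    then show ?thesis by simp
  qed
  also have "\<dots> = a * b" using ab by (simp flip: powr_add)
  also have "\<dots> = cmod (det (A * B))" by (simp add: m a_def b_def)
  finally show ?thesis .
qed

section \<open>Passage to the positive semi-definite case\<close>

text \<open>Monotone convergence controls the quadratic forms of the regularised means; polarisation turns this into
convergence of their entries.\<close>

lemma hermitian_entry_polarisation:
  assumes Y: "hermitian_mat n Y" and ij: "i < n" "j < n"
  defines "v \<equiv> \<lambda>c. unit_vec n i + c \<cdot>\<^sub>v unit_vec n j"
  shows "Y $$ (i, j) = Complex ((quad Y (v 1) - quad Y (unit_vec n i) - quad Y (unit_vec n j)) / 2)
     ((quad Y (unit_vec n i) + quad Y (unit_vec n j) - quad Y (v \<i>)) / 2)"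
proof -
  have Yc: "Y \<in> carrier_mat n n" and h: "mat_adjoint Y = Y" using Y by (auto simp: hermitian_mat_def)
  have sym: "Y $$ (b, a) = cnj (Y $$ (a, b))" if "a < n" "b < n" for a b
    using arg_cong[OF h, of "\<lambda>M. M $$ (b, a)"] Yc that by simp
  have Yu: "(Y *\<^sub>v unit_vec n b) $ a = Y $$ (a, b)" if "a < n" "b < n" for a b
    using Yc that by simp
  have Yv: "(Y *\<^sub>v v c) $ a = Y $$ (a, i) + c * Y $$ (a, j)" if "a < n" for a c
    unfolding v_def using Yc that ij by (simp add: mult_add_distrib_mat_vec[of _ n n] mult_mat_vec[of _ n n])
  have ip: "w \<bullet>c v c = w $ i + cnj c * w $ j" if "w \<in> carrier_vec n" for w c
  proof -
    have "w \<bullet>c v c = (\<Sum>a<n. w $ a * cnj ((if a = i then 1 else 0) + c * (if a = j then 1 else 0)))"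
      using that ij by (simp add: v_def scalar_prod_def atLeast0LessThan unit_vec_def)
    also have "\<dots> = (\<Sum>a<n. (if a = i then w $ a else 0) + (if a = j then cnj c * w $ a else 0))"
      by (intro sum.cong) (auto simp: algebra_simps)
    finally show ?thesis using ij by (simp add: sum.distrib)
  qed
  have iu: "w \<bullet>c unit_vec n a = w $ a" if "w \<in> carrier_vec n" "a < n" for w :: "complex vec" and a
  proof -
    have "w \<bullet>c unit_vec n a = (\<Sum>b<n. w $ b * cnj (if b = a then 1 else 0))"
      using that by (simp add: scalar_prod_def atLeast0LessThan unit_vec_def)
    also have "\<dots> = (\<Sum>b<n. if b = a then w $ b else 0)"
      by (intro sum.cong) auto
    finally show ?thesis using that by simp
  qed
  have q: "quad Y (v c) = Re (Y $$ (i, i) + c * Y $$ (i, j) + cnj c * (Y $$ (j, i) + c * Y $$ (j, j)))" for c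
  proof -
    have "v c \<in> carrier_vec n" by (simp add: v_def)
    then have "Y *\<^sub>v v c \<in> carrier_vec n" using Yc by simp
    from ip[OF this, of c] show ?thesis
      unfolding quad_def Yv[OF ij(1)] Yv[OF ij(2)] by (simp only:)
  qed
  have u: "quad Y (unit_vec n a) = Re (Y $$ (a, a))" if "a < n" for a
    unfolding quad_def using Yc that by (simp add: iu Yu)
  show ?thesis
    unfolding q u[OF ij(1)] u[OF ij(2)] sym[OF ij] by (simp add: complex_eq_iff)
qed

lemma loewner_le_shift:
  assumes A: "psd_mat n A" and e: "e \<le> e'"
  shows "loewner_le n (A + complex_of_real e \<cdot>\<^sub>m 1\<^sub>m n) (A + complex_of_real e' \<cdot>\<^sub>m 1\<^sub>m n)"
proof -
  have q: "quad (A + complex_of_real e \<cdot>\<^sub>m 1\<^sub>m n) v = quad A v + e * quad (1\<^sub>m n) v"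
    if v: "v \<in> carrier_vec n" for e v
  proof -
    have Av: "A *\<^sub>v v \<in> carrier_vec n" using psd_carrier[OF A] v by simp
    have "(A + complex_of_real e \<cdot>\<^sub>m 1\<^sub>m n) *\<^sub>v v = A *\<^sub>v v + complex_of_real e \<cdot>\<^sub>v v"
    proof -
      have "(complex_of_real e \<cdot>\<^sub>m 1\<^sub>m n) *\<^sub>v v = complex_of_real e \<cdot>\<^sub>v v"
        using v by (intro eq_vecI) (simp_all add: scalar_prod_def row_def if_distrib[of "\<lambda>x. _ * x * _"] cong: if_cong)
      then show ?thesis using psd_carrier[OF A] v by (simp add: add_mult_distrib_mat_vec[of _ n n])
    qed
    then show ?thesis using v Av
      by (simp add: quad_def add_scalar_prod_distrib[of _ n] smult_scalar_prod_distrib[of _ n])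
  qed
  show ?thesis
    unfolding loewner_le_def using e by (auto simp: q quad_one intro!: mult_right_mono sum_nonneg)
qed

lemma mono_tendsto_at_right:
  fixes f :: "real \<Rightarrow> real"
  assumes mono: "\<And>a b. 0 < a \<Longrightarrow> a \<le> b \<Longrightarrow> f a \<le> f b" and nn: "\<And>a. 0 < a \<Longrightarrow> 0 \<le> f a"
  shows "(f \<longlongrightarrow> Inf (f ` {0<..})) (at_right 0)"
proof (rule order_tendstoI)
  have bdd: "bdd_below (f ` {0<..})" using nn by (intro bdd_belowI[of _ 0]) auto
  show "\<forall>\<^sub>F x in at_right 0. a < f x" if a: "a < Inf (f ` {0<..})" for a
    using eventually_at_right_less[of "0::real"]
  proof eventually_elim
    case (elim x)
    then have "Inf (f ` {0<..}) \<le> f x" by (intro cInf_lower bdd) auto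
    then show ?case using a by simp
  qed
  show "\<forall>\<^sub>F x in at_right 0. f x < a" if a: "Inf (f ` {0<..}) < a" for a
  proof -
    obtain b where b: "0 < b" "f b < a" using cInf_lessD[OF _ a] by auto
    have "\<forall>\<^sub>F x in at_right 0. 0 < x \<and> x < b"
      unfolding eventually_at_right[OF b(1)] using b(1) by blast
    then show ?thesis
    proof eventually_elim
      case (elim x)
      then show ?case using mono[of x b] b by simp
    qed
  qed
qed

lemma geom_mean_limit_exists:
  assumes A: "psd_mat n A" and B: "psd_mat n B" and t: "0 \<le> t" "t \<le> 1"
    and ij: "i < n" "j < n"
  shows "\<exists>l. ((\<lambda>e. geom_mean_pd t (A + complex_of_real e \<cdot>\<^sub>m 1\<^sub>m n) (B + complex_of_real e \<cdot>\<^sub>m 1\<^sub>m n) $$ (i, j)) \<longlongrightarrow> l) (at_right 0)"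
proof -
  define Y where "Y e = geom_mean_pd t (A + complex_of_real e \<cdot>\<^sub>m 1\<^sub>m n) (B + complex_of_real e \<cdot>\<^sub>m 1\<^sub>m n)" for e :: real
  have Yp: "pd_mat n (Y e)" if "0 < e" for e
    unfolding Y_def by (intro geom_mean_pd_pd pd_shift A B that)
  have mono: "loewner_le n (Y e) (Y e')" if "0 < e" "e \<le> e'" for e e'
    unfolding Y_def using that by (intro geom_mean_pd_mono pd_shift loewner_le_shift A B t) auto
  have lim: "\<exists>l. ((\<lambda>e. quad (Y e) v) \<longlongrightarrow> l) (at_right 0)" if v: "v \<in> carrier_vec n" for v
  proof -
    have "((\<lambda>e. quad (Y e) v) \<longlongrightarrow> Inf ((\<lambda>e. quad (Y e) v) ` {0<..})) (at_right 0)"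
    proof (rule mono_tendsto_at_right)
      show "quad (Y a) v \<le> quad (Y b) v" if ab: "0 < a" "a \<le> b" for a b
        using mono[OF ab] v by (simp add: loewner_le_def)
      show "0 \<le> quad (Y a) v" if a: "0 < a" for a
        using psd_quad_nonneg[OF pd_imp_psd[OF Yp[OF a]] v] .
    qed
    then show ?thesis by blast
  qed
  define v where "v = (\<lambda>c::complex. unit_vec n i + c \<cdot>\<^sub>v unit_vec n j)"
  have "v c \<in> carrier_vec n" for c by (simp add: v_def)
  then obtain l1 l2 l3 l4 where l: "((\<lambda>e. quad (Y e) (v 1)) \<longlongrightarrow> l1) (at_right 0)"
    "((\<lambda>e. quad (Y e) (v \<i>)) \<longlongrightarrow> l2) (at_right 0)"
    "((\<lambda>e. quad (Y e) (unit_vec n i)) \<longlongrightarrow> l3) (at_right 0)"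
    "((\<lambda>e. quad (Y e) (unit_vec n j)) \<longlongrightarrow> l4) (at_right 0)"
    using lim[of "v 1"] lim[of "v \<i>"] lim[of "unit_vec n i"] lim[of "unit_vec n j"] by auto
  have "((\<lambda>e. Complex ((quad (Y e) (v 1) - quad (Y e) (unit_vec n i) - quad (Y e) (unit_vec n j)) / 2)
     ((quad (Y e) (unit_vec n i) + quad (Y e) (unit_vec n j) - quad (Y e) (v \<i>)) / 2))
     \<longlongrightarrow> Complex ((l1 - l3 - l4) / 2) ((l3 + l4 - l2) / 2)) (at_right 0)"
    by (intro tendsto_Complex tendsto_divide tendsto_diff tendsto_add tendsto_const l) auto
  moreover have "\<forall>\<^sub>F e in at_right 0. Complex ((quad (Y e) (v 1) - quad (Y e) (unit_vec n i) - quad (Y e) (unit_vec n j)) / 2)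
     ((quad (Y e) (unit_vec n i) + quad (Y e) (unit_vec n j) - quad (Y e) (v \<i>)) / 2) = Y e $$ (i, j)"
    using eventually_at_right_less[of "0::real"]
  proof eventually_elim
    case (elim e)
    have "hermitian_mat n (Y e)" using Yp[OF elim] by (simp add: pd_mat_def)
    from hermitian_entry_polarisation[OF this ij] show ?case by (simp add: v_def)
  qed
  ultimately have "((\<lambda>e. Y e $$ (i, j)) \<longlongrightarrow> Complex ((l1 - l3 - l4) / 2) ((l3 + l4 - l2) / 2)) (at_right 0)"
    by (simp add: tendsto_cong)
  then show ?thesis unfolding Y_def by blast
qed

lemma geom_mean_mat_lim:
  assumes A: "psd_mat n A" and B: "psd_mat n B" and t: "0 \<le> t" "t \<le> 1"
    and np: "\<not> (pd_mat n A \<and> pd_mat n B)" and e: "\<And>m. 0 < e m" "e \<longlonglongrightarrow> 0"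
  shows "mat_lim n (\<lambda>m. geom_mean_pd t (A + complex_of_real (e m) \<cdot>\<^sub>m 1\<^sub>m n) (B + complex_of_real (e m) \<cdot>\<^sub>m 1\<^sub>m n))
     (geom_mean t A B)"
proof -
  let ?Y = "\<lambda>e. geom_mean_pd t (A + complex_of_real e \<cdot>\<^sub>m 1\<^sub>m n) (B + complex_of_real e \<cdot>\<^sub>m 1\<^sub>m n)"
  have n: "dim_row A = n" using psd_carrier[OF A] by simp
  have G: "geom_mean t A B = Matrix.mat n n (\<lambda>(i, j). Lim (at_right 0) (\<lambda>e. ?Y e $$ (i, j)))"
    unfolding geom_mean_def n Let_def by (rule if_not_P[OF np])
  have er: "filterlim e (at_right 0) sequentially"
    using e by (intro filterlim_at_withinI) (auto intro!: always_eventually)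
  have "(\<lambda>m. ?Y (e m) $$ (i, j)) \<longlonglongrightarrow> Lim (at_right 0) (\<lambda>e. ?Y e $$ (i, j))" if ij: "i < n" "j < n" for i j
  proof -
    obtain l where l: "((\<lambda>e. ?Y e $$ (i, j)) \<longlongrightarrow> l) (at_right 0)"
      using geom_mean_limit_exists[OF A B t ij] by blast
    have "Lim (at_right 0) (\<lambda>e. ?Y e $$ (i, j)) = l" by (rule tendsto_Lim[OF _ l]) simp
    then show ?thesis using filterlim_compose[OF l er] by simp
  qed
  moreover have "?Y (e m) \<in> carrier_mat n n" for m
    by (intro pd_carrier geom_mean_pd_pd pd_shift A B e)
  ultimately show ?thesis unfolding mat_lim_def G by simp
qed

lemma cmod_det_eq_prod_abs_eigvals:
  assumes X: "X \<in> carrier_mat n n"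
  shows "prod_list (abs_eigvals X) = cmod (det X)"
proof -
  obtain es where es: "char_poly X = (\<Prod>e\<leftarrow>es. [:- e, 1:])" "length es = n"
    "sorted_wrt (\<lambda>a b. cmod b \<le> cmod a) es"
    using sorted_eigenvalue_list[OF X] .
  obtain T P Q where schur: "schur_decomposition X es = (T, P, Q)" by (metis prod_cases3)
  from schur_decomposition[OF X es(1) schur]
  have sim: "similar_mat_wit X T P Q" and ut: "upper_triangular T" and dg: "diag_mat T = es" by auto
  have "det X = det T" using sim by (intro det_similar) (auto simp: similar_mat_def)
  also have "\<dots> = prod_list es"
    using det_upper_triangular[OF ut] similar_mat_witD2(5)[OF X sim] dg by simp
  finally have "cmod (det X) = cmod (prod_list es)" by simp
  also have "\<dots> = prod_list (map cmod es)" by (induction es) (auto simp: norm_mult)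
  finally have "cmod (det X) = prod_list (map cmod es)" .
  then show ?thesis using abs_eigvals_sorted[OF es(1,3)] by simp
qed

lemma length_abs_eigvals:
  assumes X: "X \<in> carrier_mat n n"
  shows "length (abs_eigvals X) = n"
proof -
  obtain es where "char_poly X = (\<Prod>e\<leftarrow>es. [:- e, 1:])" "length es = n"
    "sorted_wrt (\<lambda>a b. cmod b \<le> cmod a) es"
    using sorted_eigenvalue_list[OF X] .
  then show ?thesis by (simp add: abs_eigvals_sorted)
qed

text \<open>When \<open>A\<close> and \<open>B\<close> are not both positive definite, the three factors of \<open>M\<close>, and also \<open>A B\<close>, are limits of
their analogues for the shifted matrices.  Determinants converge, and so does \<open>top_prod\<close> along a common
subsequence.\<close>

theorem psd_log_majorization:
  assumes A: "psd_mat n A" and B: "psd_mat n B" and t: "0 \<le> t" "t \<le> 1"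
  defines "M \<equiv> mat_powr A t * geom_mean t A B * mat_powr B (1 - t)"
  shows "M \<in> carrier_mat n n" "k \<le> n \<Longrightarrow> top_prod k M \<le> top_prod k (A * B)"
    "cmod (det M) = cmod (det (A * B))"
proof -
  have "M \<in> carrier_mat n n \<and> (\<forall>k\<le>n. top_prod k M \<le> top_prod k (A * B)) \<and> cmod (det M) = cmod (det (A * B))"
  proof (cases "pd_mat n A \<and> pd_mat n B")
    case True
    then have pd: "pd_mat n A" "pd_mat n B" by auto
    have "geom_mean t A B = geom_mean_pd t A B"
      unfolding geom_mean_def using psd_carrier[OF A] True by (simp add: Let_def)
    then have M: "M = mat_powr A t * geom_mean_pd t A B * mat_powr B (1 - t)" by (simp add: M_def)
    have "M \<in> carrier_mat n n" unfolding M
      by (intro mult_carrier_mat[of _ n n] mat_powr_carrier A B pd_carrier[OF geom_mean_pd_pd[OF pd]])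
    then show ?thesis using pd_log_majorization[OF pd _ t] cmod_det_pd_product[OF pd, of t] by (simp add: M)
  next
    case False
    define e where "e m = 1 / real (Suc m)" for m
    have e: "\<And>m. 0 < e m" "e \<longlonglongrightarrow> 0"
      unfolding e_def using LIMSEQ_inverse_real_of_nat by (simp_all add: inverse_eq_divide)
    define A' where "A' m = A + complex_of_real (e m) \<cdot>\<^sub>m 1\<^sub>m n" for m
    define B' where "B' m = B + complex_of_real (e m) \<cdot>\<^sub>m 1\<^sub>m n" for m
    define M' where "M' m = mat_powr (A' m) t * geom_mean_pd t (A' m) (B' m) * mat_powr (B' m) (1 - t)" for m
    have pd: "pd_mat n (A' m)" "pd_mat n (B' m)" for m
      unfolding A'_def B'_def by (intro pd_shift A B e)+
    have limM: "mat_lim n M' M"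
      unfolding M'_def M_def A'_def B'_def
      by (intro mat_lim_mult mat_powr_lim_shift geom_mean_mat_lim A B t e False) (use t in auto)
    have limA: "mat_lim n A' A"
      using mat_powr_lim_shift[OF A _ e, of 1] mat_powr_one[OF pd_imp_psd[OF pd(1)]] mat_powr_one[OF A]
      by (simp add: A'_def[symmetric])
    have limB: "mat_lim n B' B"
      using mat_powr_lim_shift[OF B _ e, of 1] mat_powr_one[OF pd_imp_psd[OF pd(2)]] mat_powr_one[OF B]
      by (simp add: B'_def[symmetric])
    have limAB: "mat_lim n (\<lambda>m. A' m * B' m) (A * B)" by (rule mat_lim_mult[OF limA limB])
    have "top_prod k M \<le> top_prod k (A * B)" if k: "k \<le> n" for k
    proof -
      obtain r where r: "strict_mono r" "(\<lambda>m. top_prod k (M' (r m))) \<longlonglongrightarrow> top_prod k M"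
        by (rule top_prod_lim_subseq[OF limM k])
      obtain s where s: "strict_mono s" "(\<lambda>m. top_prod k (A' (r (s m)) * B' (r (s m)))) \<longlonglongrightarrow> top_prod k (A * B)"
        by (rule top_prod_lim_subseq[OF mat_lim_subseq[OF limAB r(1)] k])
      have "(\<lambda>m. top_prod k (M' (r (s m)))) \<longlonglongrightarrow> top_prod k M"
        using LIMSEQ_subseq_LIMSEQ[OF r(2) s(1)] by (simp add: o_def)
      then show ?thesis
        by (rule LIMSEQ_le[OF _ s(2)]) (use pd_log_majorization[OF pd k t] in \<open>auto simp: M'_def\<close>)
    qed
    moreover have "cmod (det M) = cmod (det (A * B))"
    proof (rule LIMSEQ_unique)
      show "(\<lambda>m. cmod (det (M' m))) \<longlonglongrightarrow> cmod (det M)" by (intro tendsto_norm det_lim[OF limM])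
      have "cmod (det (M' m)) = cmod (det (A' m * B' m))" for m
        unfolding M'_def by (rule cmod_det_pd_product[OF pd])
      then show "(\<lambda>m. cmod (det (M' m))) \<longlonglongrightarrow> cmod (det (A * B))"
        using tendsto_norm[OF det_lim[OF limAB]] by simp
    qed
    ultimately show ?thesis using mat_limD(2)[OF limM] by blast
  qed
  then show "M \<in> carrier_mat n n" "k \<le> n \<Longrightarrow> top_prod k M \<le> top_prod k (A * B)"
    "cmod (det M) = cmod (det (A * B))" by auto
qed

section \<open>Log-majorization\<close>

lemma psd_gram_factorised:
  assumes B: "psd_mat n B"
  obtains R where "R \<in> carrier_mat n n" "B = mat_adjoint R * R"
proof -
  obtain U d where U: "unitary_mat n U" and BU: "B = U * diag_real n d * mat_adjoint U"
    and d: "\<And>i. i < n \<Longrightarrow> 0 \<le> d i"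
    using psd_spectral[OF B] by metis
  define D where "D = diag_real n (\<lambda>i. sqrt (d i))"
  have D: "D \<in> carrier_mat n n" "mat_adjoint D = D" unfolding D_def by (simp_all only: adjoint_diag_real mat_diag_dim)
  have DD: "D * D = diag_real n d"
    unfolding D_def mat_diag_diag
  proof (rule mat_diag_cong)
    fix i assume "i < n"
    then have "sqrt (d i) * sqrt (d i) = d i" using d by simp
    then show "complex_of_real (sqrt (d i)) * complex_of_real (sqrt (d i)) = complex_of_real (d i)"
      by (metis of_real_mult)
  qed
  have "B = mat_adjoint (D * mat_adjoint U) * (D * mat_adjoint U)"
    unfolding BU DD[symmetric] using D unitaryD(1)[OF U]
    by (simp add: assoc_mult_mat[of _ n n _ n _ n] mult_carrier_mat[of _ n n _ n] adjoint_mult[of _ n n _ n])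
  moreover have "D * mat_adjoint U \<in> carrier_mat n n"
    using D unitaryD(1)[OF U] by (simp add: mult_carrier_mat[of _ n n _ n])
  ultimately show ?thesis using that by blast
qed

text \<open>If \<open>A B v = e v\<close> and \<open>w = B v\<close>, pairing with \<open>w\<close> gives \<open>x = e y\<close>, where \<open>x\<close> and \<open>y\<close> are the values of the
quadratic forms of \<open>A\<close> at \<open>w\<close> and of \<open>B\<close> at \<open>v\<close>.  If \<open>y\<close> vanishes, then so does \<open>w\<close>, and \<open>e = 0\<close>.\<close>

lemma psd_product_eigenvalue_nonneg:
  assumes A: "psd_mat n A" and B: "psd_mat n B" and ev: "eigenvalue (A * B) e"
  shows "e = complex_of_real (cmod e)"
proof (cases "e = 0")
  case False
  note c = psd_carrier[OF A] psd_carrier[OF B]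
  obtain R where R: "R \<in> carrier_mat n n" "B = mat_adjoint R * R" using psd_gram_factorised[OF B] .
  obtain S where S: "S \<in> carrier_mat n n" "A = mat_adjoint S * S" using psd_gram_factorised[OF A] .
  obtain v where v: "v \<in> carrier_vec n" "v \<noteq> 0\<^sub>v n" and ABv: "(A * B) *\<^sub>v v = e \<cdot>\<^sub>v v"
    using ev c by (auto simp: eigenvalue_def eigenvector_def)
  define w where "w = B *\<^sub>v v"
  have w: "w \<in> carrier_vec n" using c v by (simp add: w_def)
  have Aw: "A *\<^sub>v w = e \<cdot>\<^sub>v v" using ABv c v by (simp add: w_def assoc_mult_mat_vec[of _ n n _ n])
  have gram: "((mat_adjoint X * X) *\<^sub>v u) \<bullet>c u = (X *\<^sub>v u) \<bullet>c (X *\<^sub>v u)"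
    if "X \<in> carrier_mat n n" "u \<in> carrier_vec n" for X :: "complex mat" and u
    using quad_form_congruence[OF one_carrier_mat that] that by simp
  define x where "x = (\<Sum>i<n. (cmod ((S *\<^sub>v w) $ i))\<^sup>2)"
  define y where "y = (\<Sum>i<n. (cmod ((R *\<^sub>v v) $ i))\<^sup>2)"
  have Rv: "R *\<^sub>v v \<in> carrier_vec n" and Sw: "S *\<^sub>v w \<in> carrier_vec n" using R S v w by auto
  have x: "(A *\<^sub>v w) \<bullet>c w = complex_of_real x"
    unfolding S(2) gram[OF S(1) w] x_def by (rule inner_self[OF Sw])
  have y: "(B *\<^sub>v v) \<bullet>c v = complex_of_real y"
    unfolding R(2) gram[OF R(1) v(1)] y_def by (rule inner_self[OF Rv])
  have "(A *\<^sub>v w) \<bullet>c w = e * (v \<bullet>c w)"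
    unfolding Aw using v w by (simp add: smult_scalar_prod_distrib[of _ n])
  also have "v \<bullet>c w = (B *\<^sub>v v) \<bullet>c v"
    using inner_adjoint[OF c(2) v(1) v(1)] B by (simp add: w_def psd_mat_def hermitian_mat_def)
  finally have xy: "complex_of_real x = e * complex_of_real y" by (simp only: x y)
  have nn: "0 \<le> x" "0 \<le> y" by (auto simp: x_def y_def intro!: sum_nonneg)
  have "y \<noteq> 0"
  proof
    assume "y = 0"
    then have "(R *\<^sub>v v) \<bullet>c (R *\<^sub>v v) = 0" using inner_self[OF Rv] by (simp add: y_def)
    then have "R *\<^sub>v v = 0\<^sub>v n" using conjugate_square_eq_0_vec[OF Rv] by simp
    then have "w = 0\<^sub>v n" unfolding w_def R(2)
      using R(1) v by (simp add: assoc_mult_mat_vec[of _ n n _ n]) (auto simp: scalar_prod_def intro!: eq_vecI)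
    then have "e \<cdot>\<^sub>v v = 0\<^sub>v n" unfolding Aw[symmetric] using c by (auto simp: scalar_prod_def intro!: eq_vecI)
    then have "(e \<cdot>\<^sub>v v) $ i = 0" if "i < n" for i using that by simp
    then have "v $ i = 0" if "i < n" for i using v(1) that False by simp
    then show False using v nonzero_vec_index by metis
  qed
  then have "e = complex_of_real (x / y)" using xy by (simp add: field_simps)
  moreover have "0 \<le> x / y" using nn by simp
  ultimately show ?thesis by (simp only: norm_of_real abs_of_nonneg)
qed simp

lemma real_eigvals_psd_product:
  assumes A: "psd_mat n A" and B: "psd_mat n B"
  shows "real_eigvals (A * B) = abs_eigvals (A * B)"
proof -
  have AB: "A * B \<in> carrier_mat n n" by (rule mult_carrier_mat[OF psd_carrier[OF A] psd_carrier[OF B]])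
  obtain es where es: "char_poly (A * B) = (\<Prod>e\<leftarrow>es. [:- e, 1:])" "length es = n"
    "sorted_wrt (\<lambda>a b. cmod b \<le> cmod a) es"
    using sorted_eigenvalue_list[OF AB] .
  have "e = complex_of_real (cmod e)" if "e \<in> set es" for e
  proof (rule psd_product_eigenvalue_nonneg[OF A B])
    have "poly (\<Prod>e\<leftarrow>es. [:- e, 1:]) e = 0" using that by (auto simp: poly_prod_list prod_list_zero_iff)
    then show "eigenvalue (A * B) e" by (simp add: eigenvalue_root_char_poly[OF AB] es(1))
  qed
  then have "map complex_of_real (map cmod es) = es" by (simp add: map_idI)
  then have ms: "image_mset complex_of_real (mset (map cmod es)) = eigvals_mset (A * B)"
    unfolding eigvals_mset_prod[OF es(1)] by (metis mset_map)
  have srt: "sorted_wrt (\<ge>) (map cmod es)" using es(3) by (simp add: sorted_wrt_map)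
  show ?thesis
    unfolding real_eigvals_def abs_eigvals_sorted[OF es(1,3)]
  proof (rule the_equality)
    fix xs assume xs: "sorted_wrt (\<ge>) xs \<and> image_mset complex_of_real (mset xs) = eigvals_mset (A * B)"
    then have "image_mset complex_of_real (mset xs) = image_mset complex_of_real (mset (map cmod es))" using ms by simp
    then have "mset xs = mset (map cmod es)"
      using injD[OF multiset.inj_map, of complex_of_real] by (simp only: inj_of_real)
    moreover have "sorted (rev xs)" "sorted (rev (map cmod es))" using xs srt by (auto simp: sorted_wrt_rev)
    ultimately have "rev xs = rev (map cmod es)" by (metis mset_rev properties_for_sort)
    then show "xs = map cmod es" by simp
  qed (use ms srt in simp)
qed

theorem theorem3p2:
  fixes n :: nat and A B :: "complex mat" and t :: real
  assumes "psd_mat n A" and "psd_mat n B"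
    and "0 \<le> t" and "t \<le> 1"
  shows "abs_eigvals (mat_powr A t * geom_mean t A B * mat_powr B (1 - t)) \<prec>log real_eigvals (A * B)"
proof -
  let ?M = "mat_powr A t * geom_mean t A B * mat_powr B (1 - t)"
  note lim = psd_log_majorization[OF assms]
  have AB: "A * B \<in> carrier_mat n n"
    by (rule mult_carrier_mat[OF psd_carrier[OF assms(1)] psd_carrier[OF assms(2)]])
  have len: "length (abs_eigvals ?M) = n" by (rule length_abs_eigvals[OF lim(1)])
  have "prod_list (take k (abs_eigvals ?M)) \<le> prod_list (take k (abs_eigvals (A * B)))"
    if "k \<in> {1..length (abs_eigvals ?M) - 1}" for k
    using lim(2)[of k] that len by (auto simp: top_prod_def)
  moreover have "prod_list (abs_eigvals ?M) = prod_list (abs_eigvals (A * B))"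
    using lim(3) by (simp add: cmod_det_eq_prod_abs_eigvals[OF lim(1)] cmod_det_eq_prod_abs_eigvals[OF AB])
  ultimately show ?thesis
    unfolding log_majorized_def real_eigvals_psd_product[OF assms(1,2)]
    using len length_abs_eigvals[OF AB] by simp
qed

end
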